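(* Let $n\ge 2$, $q\ge 1$, $\mathcal{D}=\mathbb{C}[D_1,\dots,D_n]$, $\mathcal{F}=\mathcal{C}^\infty(\mathsf{PT})_{\mathsf{fin}}[x_1,\dots,x_n]$, and let $\mathcal{M}$ be a submodule of $\mathcal{D}^q$. Then the Willems closure $\mathcal{M}^{\perp\perp}$ of $\mathcal{M}$ with respect to $\mathcal{F}$ consists of the elements $x\in\mathcal{D}^q$ for which the ideal $\{r\in\mathcal{D} : rx\in\mathcal{M}\}$ is not contained in any maximal ideal of the form $(D_1-b_1,\dots,D_n-b_n)$ with $(b_1,\dots,b_n)\in\mathbb{Q}^n$. In other words, $\mathcal{M}^{\perp\perp}$ is the largest submodule $\mathcal{M}^+$ of $\mathcal{D}^q$ containing $\mathcal{M}$ such that the support $S\subset\mathbb{A}^n=\mathbb{C}^n$ of $\mathcal{M}^+/\mathcal{M}$ satisfies $S\cap\mathbb{Q}^n=\emptyset$.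
   Context: $\mathcal{D}=\mathbb{C}[D_1,\dots,D_n]$ is the commutative polynomial ring of constant coefficient differential operators on $\mathbb{R}^n$, with $D_j=\frac{1}{\imath}\frac{\partial}{\partial x_j}$, acting on smooth complex-valued functions on $\mathbb{R}^n$. A point $b\in\mathbb{C}^n$ corresponds to the maximal ideal $(D_1-b_1,\dots,D_n-b_n)$; the support of a finitely generated module $N$ is the set of $b\in\mathbb{C}^n$ whose maximal ideal contains the annihilator of $N$. $\mathcal{C}^\infty(\mathsf{PT})_{\mathsf{fin}}$ is the complex vector space of finite sums $\sum_{a\in\mathbb{Q}^n}c_a e^{\imath\langle a,x\rangle}$, $c_a\in\mathbb{C}$, with $\langle a,x\rangle=\sum_j a_jx_j$. $\mathcal{C}^\infty(\mathsf{PT})_{\mathsf{fin}}[x_1,\dots,x_n]$ is the subalgebra of $\mathcal{C}^\infty(\mathbb{R}^n)$ generated by it and the coordinate functions; its elements are the finite sums $\sum_{a\in\mathbb{Q}^n}p_a(x)e^{\imath\langle a,x\rangle}$ with $p_a\in\mathbb{C}[x_1,\dots,x_n]$. It is a $\mathcal{D}$-module. For a submodule $\mathcal{M}\subset\mathcal{D}^q$, its behavior is $\mathcal{M}^\perp=\{(f_1,\dots,f_q)\in\mathcal{F}^q : \sum_j r_j(f_j)=0 \text{ for all } (r_1,\dots,r_q)\in\mathcal{M}\}$. For a behavior $\mathcal{B}\subset\mathcal{F}^q$, $\mathcal{B}^\perp=\{(r_1,\dots,r_q)\in\mathcal{D}^q : \sum_j r_j(f_j)=0 \text{ for all } (f_1,\dots,f_q)\in\mathcal{B}\}$.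 The Willems closure of $\mathcal{M}$ with respect to $\mathcal{F}$ is $\mathcal{M}^{\perp\perp}\subset\mathcal{D}^q$. *)

theory Defs
  imports "HOL-Analysis.Analysis" "HOL-Library.Poly_Mapping"
begin

section \<open>Constant coefficient differential operators\<close>

text \<open>The ring $\mathbb{C}[D_1,\dots,D_n]$ with $n = $ \<open>CARD('n)\<close>: finitely supported maps
  from exponent vectors to coefficients, with convolution as multiplication.\<close>

type_synonym 'n diffop = "('n \<Rightarrow>\<^sub>0 nat) \<Rightarrow>\<^sub>0 complex"

definition D_var :: "'n \<Rightarrow> 'n diffop" where
  "D_var j = Poly_Mapping.single (Poly_Mapping.single j 1) 1"

definition D_const :: "complex \<Rightarrow> 'n diffop" where
  "D_const c = Poly_Mapping.single 0 c"

interpretation diffop_ring: module "(*) :: 'n diffop \<Rightarrow> 'n diffop \<Rightarrow> 'n diffop"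
  by unfold_locales (auto simp: algebra_simps)

interpretation diffop_free: module
  "(*s) :: 'n diffop \<Rightarrow> 'n diffop ^ 'q \<Rightarrow> 'n diffop ^ 'q"
  by unfold_locales (auto simp: vec_eq_iff algebra_simps)

text \<open>Thus \<open>diffop_free.subspace\<close> is the predicate ``submodule of $\mathcal{D}^q$''
  and \<open>diffop_ring.span\<close> is the ideal of $\mathcal{D}$ generated by a set.\<close>

section \<open>Action on functions\<close>

definition D_partial :: "'n \<Rightarrow> (real ^ 'n \<Rightarrow> complex) \<Rightarrow> (real ^ 'n \<Rightarrow> complex)" where
  "D_partial j f = (\<lambda>x. 1 / \<i> * vector_derivative (\<lambda>t. f (x + t *\<^sub>R axis j 1)) (at 0))"

text \<open>An arbitrary enumeration of the variables, needed only to write down an iterated partial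
  derivative. On smooth functions partial derivatives commute, so its choice is immaterial.\<close>

definition var_list :: "'n::finite list" where
  "var_list = (SOME xs. distinct xs \<and> set xs = UNIV)"

definition D_monom ::
    "('n::finite \<Rightarrow>\<^sub>0 nat) \<Rightarrow> (real ^ 'n \<Rightarrow> complex) \<Rightarrow> (real ^ 'n \<Rightarrow> complex)" where
  "D_monom m f = foldr (\<lambda>j. D_partial j ^^ Poly_Mapping.lookup m j) var_list f"

definition D_apply ::
    "('n::finite) diffop \<Rightarrow> (real ^ 'n \<Rightarrow> complex) \<Rightarrow> (real ^ 'n \<Rightarrow> complex)" where
  "D_apply p f = (\<lambda>x. \<Sum>m\<in>Poly_Mapping.keys p. Poly_Mapping.lookup p m * D_monom m f x)"

section \<open>The signal space\<close>

definition rat_points :: "('a::field_char_0 ^ 'n) set" where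
  "rat_points = {b. \<forall>j. b $ j \<in> \<rat>}"

definition PT_fin :: "(real ^ 'n \<Rightarrow> complex) set" where
  "PT_fin = {f. \<exists>A c. finite A \<and> A \<subseteq> rat_points \<and>
                 f = (\<lambda>x. \<Sum>a\<in>A. c a * exp (\<i> * complex_of_real (a \<bullet> x)))}"

text \<open>The subalgebra generated by \<open>PT_fin\<close> and the coordinate functions. Every constant function
  is in \<open>PT_fin\<close> (take \<open>A = {0}\<close>), so the unit and scalar multiples are covered by \<open>times\<close>.\<close>

inductive_set PT_fin_poly :: "(real ^ 'n \<Rightarrow> complex) set" where
  base: "f \<in> PT_fin \<Longrightarrow> f \<in> PT_fin_poly"
| coord: "(\<lambda>x. complex_of_real (x $ j)) \<in> PT_fin_poly"
| plus: "f \<in> PT_fin_poly \<Longrightarrow> g \<in> PT_fin_poly \<Longrightarrow> (\<lambda>x. f x + g x) \<in> PT_fin_poly"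
| times: "f \<in> PT_fin_poly \<Longrightarrow> g \<in> PT_fin_poly \<Longrightarrow> (\<lambda>x. f x * g x) \<in> PT_fin_poly"

section \<open>Behaviors and the Willems closure\<close>

definition row_apply ::
    "('n::finite) diffop ^ 'q \<Rightarrow> (real ^ 'n \<Rightarrow> complex) ^ 'q \<Rightarrow> (real ^ 'n \<Rightarrow> complex)" where
  "row_apply r f = (\<lambda>x. \<Sum>j\<in>UNIV. D_apply (r $ j) (f $ j) x)"

definition behavior ::
    "(('n::finite) diffop ^ 'q) set \<Rightarrow> ((real ^ 'n \<Rightarrow> complex) ^ 'q) set" where
  "behavior M = {f. (\<forall>j. f $ j \<in> PT_fin_poly) \<and> (\<forall>r\<in>M. row_apply r f = (\<lambda>x. 0))}"

definition behavior_perp ::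
    "((real ^ 'n::finite \<Rightarrow> complex) ^ 'q) set \<Rightarrow> ('n diffop ^ 'q) set" where
  "behavior_perp B = {r. \<forall>f\<in>B. row_apply r f = (\<lambda>x. 0)}"

definition willems_closure :: "(('n::finite) diffop ^ 'q) set \<Rightarrow> ('n diffop ^ 'q) set" where
  "willems_closure M = behavior_perp (behavior M)"

section \<open>Support of a subquotient of the free module\<close>

definition point_ideal :: "complex ^ 'n \<Rightarrow> 'n diffop set" where
  "point_ideal b = diffop_ring.span {D_var j - D_const (b $ j) | j. True}"

text \<open>For submodules \<open>M \<subseteq> N\<close>, the module $N/M$ as a set of cosets, with scalar multiplication
  \<open>r (x + M) = r x + M\<close>; its zero element is the coset \<open>M\<close>.\<close>

definition quot_module ::
    "('n diffop ^ 'q) set \<Rightarrow> ('n diffop ^ 'q) set \<Rightarrow> ('n diffop ^ 'q) set set" where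
  "quot_module N M = (\<lambda>x. (+) x ` M) ` N"

definition quot_scale ::
    "('n diffop ^ 'q) set \<Rightarrow> 'n diffop \<Rightarrow> ('n diffop ^ 'q) set \<Rightarrow> ('n diffop ^ 'q) set" where
  "quot_scale M r C = {r *s x + m | x m. x \<in> C \<and> m \<in> M}"

definition quot_annihilator ::
    "('n diffop ^ 'q) set \<Rightarrow> ('n diffop ^ 'q) set \<Rightarrow> 'n diffop set" where
  "quot_annihilator N M = {r. \<forall>C\<in>quot_module N M. quot_scale M r C = M}"

definition quot_support ::
    "('n diffop ^ 'q) set \<Rightarrow> ('n diffop ^ 'q) set \<Rightarrow> (complex ^ 'n) set" where
  "quot_support N M = {b. quot_annihilator N M \<subseteq> point_ideal b}"

end

theory Submission
  imports Defs "HOL-Computational_Algebra.Primes"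
begin

text \<open>Let \<open>I\<close> be the ideal of all \<open>r\<close> with \<open>r x \<in> M\<close>, and let \<open>f\<close> be in the behavior of \<open>M\<close>, so that
  \<open>I\<close> kills the signal \<open>g = x(f)\<close>. A signal is a finite sum of polynomials times exponentials \<open>e\<^sub>a\<close>
  with \<open>a\<close> rational, and an operator \<open>r\<close> with \<open>r(a) = 1\<close> acts on the summand at \<open>a\<close> as
  the identity plus a locally nilpotent map. If \<open>I\<close> has no rational zero, it therefore
  contains an operator fixing \<open>g\<close>, and \<open>g = 0\<close>.

  If \<open>I\<close> vanishes at a rational point \<open>b\<close>, Krull's intersection theorem shows that \<open>x\<close> is not in
  \<open>M\<close> plus a suitable power of the maximal ideal of \<open>b\<close>. A complex linear functional separating \<open>x\<close>
  from this subspace consists of the Taylor coefficients of a polynomial times \<open>e\<^sub>b\<close>, which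
  solves all equations of \<open>M\<close> but not \<open>x\<close>.\<close>

section \<open>The polynomial ring and translations of the variables\<close>

text \<open>Krull's theorem is used in a global form: it must yield an operator \<open>r\<close>
  with value 1 at \<open>b\<close> and \<open>r *s x\<close> in \<open>M\<close>, since this is
  precisely an element of I outside the ideal of \<open>b\<close>. It rests on an Artin-Rees
  inclusion for L = D x + M: elements of L of high order at the origin are combinations of
  generators of L with coefficients vanishing there. The obstacle is that division along a
  well-order of monomials cancels the largest terms, whereas the order at a point is governed by the
  lowest ones. Dickson's lemma, stated for arbitrary numerical functions, lets the reducing element
  be chosen with control of both. The same division gives finite generation, which carries the
  condition on single elements over to the support of the whole quotient. A general \<open>b\<close>
  is reduced to the origin by substituting D_j + b_j for D_j, which on signals is conjugation by an
  exponential. As derivatives of arbitrary functions obey no module laws, these laws are proved on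
  the signal algebra only, by induction over its generators.\<close>

lemma lookup_mult_zero_nat:
  fixes p q :: "('n \<Rightarrow>\<^sub>0 nat) \<Rightarrow>\<^sub>0 'a::semiring_0"
  shows "Poly_Mapping.lookup (p * q) 0 = Poly_Mapping.lookup p 0 * Poly_Mapping.lookup q 0"
proof -
  have *: "(0 = u + v) \<longleftrightarrow> u = 0 \<and> v = 0" for u v :: "'n \<Rightarrow>\<^sub>0 nat"
    by (auto simp: poly_mapping_eq_iff lookup_add fun_eq_iff)
  have "Sum_any (\<lambda>v. Poly_Mapping.lookup q v when 0 = u + v) = (Poly_Mapping.lookup q 0 when u = 0)" for u :: "'n \<Rightarrow>\<^sub>0 nat"
    by (cases "u = 0") (simp_all add: *)
  then show ?thesis
    by (simp add: lookup_mult mult_when)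
qed

lemma poly_mapping_sum_singles:
  "p = (\<Sum>m\<in>Poly_Mapping.keys p. Poly_Mapping.single m (Poly_Mapping.lookup p m))"
  by (rule poly_mapping_eqI)
     (auto simp: lookup_sum lookup_single when_def in_keys_iff)

lemma poly_mapping_single_induct [case_names zero single plus]:
  fixes p :: "'k \<Rightarrow>\<^sub>0 'a::comm_monoid_add"
  assumes "P 0" "\<And>m c. P (Poly_Mapping.single m c)" "\<And>p q. P p \<Longrightarrow> P q \<Longrightarrow> P (p + q)"
  shows "P p"
proof -
  have "P (\<Sum>m\<in>K. Poly_Mapping.single m (Poly_Mapping.lookup p m))" if "finite K" for K
    using that by induction (auto intro: assms)
  then show ?thesis
    using poly_mapping_sum_singles[of p] by (metis finite_keys)
qed

lemma single_one_add:
  fixes u v :: "'n \<Rightarrow>\<^sub>0 nat"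
  shows "Poly_Mapping.single (u + v) (1::'a::comm_semiring_1) = Poly_Mapping.single u 1 * Poly_Mapping.single v 1"
  by (simp add: mult_single)

lemma D_var_power: "D_var j ^ k = Poly_Mapping.single (Poly_Mapping.single j k) 1"
proof (induction k)
  case 0
  then show ?case by (simp flip: single_one)
next
  case (Suc k)
  have "Poly_Mapping.single j (Suc k) = Poly_Mapping.single j 1 + Poly_Mapping.single j k"
    by (simp flip: single_add)
  then show ?case using Suc by (simp add: D_var_def mult_single)
qed

lemma D_const_0 [simp]: "D_const 0 = 0"
  and D_const_1 [simp]: "D_const 1 = 1"
  and D_const_add: "D_const (a + b) = D_const a + D_const b"
  and D_const_mult: "D_const (a * b) = D_const a * D_const b"
  by (simp_all add: D_const_def single_add mult_single)

text \<open>Meant for identities between ring homomorphisms or module actions: being compatible with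
  sums and products, they only have to be checked on constants and single variables.\<close>

lemma diffop_induct [case_names const var plus mult]:
  fixes p :: "'n diffop"
  assumes const: "\<And>c. P (D_const c)" and var: "\<And>j. P (D_var j)"
    and plus: "\<And>p q. P p \<Longrightarrow> P q \<Longrightarrow> P (p + q)" and mult: "\<And>p q. P p \<Longrightarrow> P q \<Longrightarrow> P (p * q)"
  shows "P p"
proof (induction p rule: poly_mapping_single_induct)
  case zero
  then show ?case using const[of 0] by simp
next
  case (single m c)
  have "P (Poly_Mapping.single m 1)"
  proof (induction m rule: poly_mapping_single_induct)
    case zero
    then show ?case using const[of 1] by (simp add: D_const_def)
  next
    case (single j k)
    have "P (D_var j ^ k)"
      by (induction k) (use const[of 1] var mult in auto)
    then show ?case by (simp add: D_var_power)
  next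
    case (plus u v)
    then show ?case using mult by (simp add: single_one_add)
  qed
  then show ?case using mult[OF const[of c]] by (fastforce simp: D_const_def mult_single)
next
  case (plus p q)
  then show ?case by (rule assms(3))
qed

text \<open>Taylor expansion at \<open>b\<close>, a ring automorphism. It moves the point
  \<open>b\<close> to the origin, where values and orders of vanishing can be read off the
  exponents.\<close>

definition shift :: "complex ^ 'n \<Rightarrow> ('n::finite) diffop \<Rightarrow> 'n diffop" where
  "shift b p = (\<Sum>m\<in>Poly_Mapping.keys p.
     D_const (Poly_Mapping.lookup p m) * (\<Prod>j\<in>UNIV. (D_var j + D_const (b $ j)) ^ Poly_Mapping.lookup m j))"

lemma shift_superset:
  assumes "finite K" "Poly_Mapping.keys p \<subseteq> K"
  shows "shift b p = (\<Sum>m\<in>K. D_const (Poly_Mapping.lookup p m) * (\<Prod>j\<in>UNIV. (D_var j + D_const (b $ j)) ^ Poly_Mapping.lookup m j))"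
  unfolding shift_def using assms
  by (intro sum.mono_neutral_left) (auto simp: in_keys_iff)

lemma shift_add: "shift b (p + q) = shift b p + shift b q"
proof -
  let ?K = "Poly_Mapping.keys p \<union> Poly_Mapping.keys q"
  have "Poly_Mapping.keys (p + q) \<subseteq> ?K" by (rule keys_add)
  then show ?thesis
    by (simp add: shift_superset[of ?K] lookup_add D_const_add ring_distribs sum.distrib)
qed

lemma shift_0 [simp]: "shift b 0 = 0"
  by (simp add: shift_def)

lemma shift_single:
  "shift b (Poly_Mapping.single m c) = D_const c * (\<Prod>j\<in>UNIV. (D_var j + D_const (b $ j)) ^ Poly_Mapping.lookup m j)"
  by (cases "c = 0") (simp_all add: shift_def)

lemma shift_mult: "shift b (p * q) = shift b p * shift b q"
proof (induction p rule: poly_mapping_single_induct)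
  case (single m c)
  show ?case
  proof (induction q rule: poly_mapping_single_induct)
    case (single m' c')
    show ?case
      unfolding mult_single shift_single D_const_mult lookup_add power_add prod.distrib
      by (simp only: mult_ac)
  qed (simp_all only: shift_add ring_distribs mult_zero_right shift_0)
qed (simp_all only: shift_add ring_distribs mult_zero_left shift_0)

lemma shift_const [simp]: "shift b (D_const c) = D_const c"
  by (simp add: D_const_def shift_single)

lemma shift_var [simp]: "shift b (D_var j) = D_var j + D_const (b $ j)"
proof -
  have "(\<Prod>i\<in>UNIV. (D_var i + D_const (b $ i)) ^ Poly_Mapping.lookup (Poly_Mapping.single j 1) i)
      = (\<Prod>i\<in>UNIV. if i = j then D_var i + D_const (b $ i) else 1)"
    by (intro prod.cong) (auto simp: lookup_single when_def)
  then show ?thesis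
    by (subst D_var_def) (simp add: shift_single)
qed

lemma shift_1 [simp]: "shift b 1 = 1"
  using shift_const[of b 1] by simp

lemma shift_uminus: "shift b (- p) = - shift b p"
  using shift_add[of b p "- p"] by (simp add: eq_neg_iff_add_eq_0 add.commute)

lemma shift_diff: "shift b (p - q) = shift b p - shift b q"
  using shift_add[of b p "- q"] by (simp add: shift_uminus)

lemma shift_shift: "shift b (shift c p) = shift (b + c) p"
  by (induction p rule: diffop_induct) (simp_all add: shift_add shift_mult D_const_add)

lemma shift_by_0 [simp]: "shift 0 p = p"
  by (induction p rule: diffop_induct) (simp_all add: shift_add shift_mult)

text \<open>The value of the polynomial at \<open>b\<close>. As a constant coefficient after
  translation it inherits multiplicativity from \<open>shift\<close> and is directly comparable with
  the conclusion of Krull's theorem at the origin.\<close>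

definition poly_at :: "complex ^ 'n \<Rightarrow> ('n::finite) diffop \<Rightarrow> complex" where
  "poly_at b p = Poly_Mapping.lookup (shift b p) 0"

lemma poly_at_add: "poly_at b (p + q) = poly_at b p + poly_at b q"
  and poly_at_diff: "poly_at b (p - q) = poly_at b p - poly_at b q"
  and poly_at_mult: "poly_at b (p * q) = poly_at b p * poly_at b q"
  and poly_at_const [simp]: "poly_at b (D_const c) = c"
  and poly_at_1 [simp]: "poly_at b 1 = 1"
  and poly_at_0 [simp]: "poly_at b 0 = 0"
  by (simp_all add: poly_at_def shift_add shift_diff lookup_add lookup_minus shift_mult lookup_mult_zero_nat
      D_const_def[abs_def] shift_const[unfolded D_const_def])

lemma poly_at_var [simp]: "poly_at b (D_var j) = b $ j"
  by (simp add: poly_at_def lookup_add, simp add: D_var_def D_const_def lookup_single poly_mapping_eq_iff when_def fun_eq_iff)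

lemma diff_poly_at_in_point_ideal: "p - D_const (poly_at b p) \<in> point_ideal b"
proof (induction p rule: diffop_induct)
  case (const c)
  then show ?case by (simp add: point_ideal_def diffop_ring.span_zero)
next
  case (var j)
  then show ?case by (auto simp: point_ideal_def intro!: diffop_ring.span_base)
next
  case (plus p q)
  have "p + q - D_const (poly_at b (p + q)) = (p - D_const (poly_at b p)) + (q - D_const (poly_at b q))"
    by (simp add: poly_at_add D_const_add)
  then show ?case
    using diffop_ring.span_add[OF plus[unfolded point_ideal_def]] by (simp only: point_ideal_def)
next
  case (mult p q)
  have "p * q - D_const (poly_at b (p * q)) = q * (p - D_const (poly_at b p)) + D_const (poly_at b p) * (q - D_const (poly_at b q))"
    by (simp add: poly_at_mult D_const_mult algebra_simps)
  then show ?case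
    using diffop_ring.span_add[OF diffop_ring.span_scale diffop_ring.span_scale, OF mult[unfolded point_ideal_def]]
    by (simp only: point_ideal_def)
qed

text \<open>Replaces membership in a generated ideal by one equation in a field, from which
  properness and primality are immediate.\<close>

lemma point_ideal_eq: "point_ideal b = {p. poly_at b p = 0}"
proof
  have "diffop_ring.subspace {p. poly_at b p = 0}"
    by (auto simp: diffop_ring.subspace_def poly_at_add poly_at_mult)
  then show "point_ideal b \<subseteq> {p. poly_at b p = 0}"
    unfolding point_ideal_def by (intro diffop_ring.span_minimal) (auto simp: poly_at_diff)
  show "{p. poly_at b p = 0} \<subseteq> point_ideal b"
    using diff_poly_at_in_point_ideal[of _ b] by auto (metis D_const_0 diff_zero)
qed

section \<open>The Artin--Rees lemma and the Krull intersection theorem\<close>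

text \<open>Stated for arbitrary numerical functions on an arbitrary type, so that exponents of
  leading monomials and further invariants such as the order can be compared simultaneously.\<close>

lemma dickson:
  fixes A :: "('i \<Rightarrow> nat) set"
  assumes "finite A"
  shows "\<exists>B\<subseteq>S. finite B \<and> (\<forall>s\<in>S. \<exists>b\<in>B. \<forall>f\<in>A. f b \<le> f s)"
  using assms
proof (induction A arbitrary: S)
  case empty
  show ?case
  proof (cases "S = {}")
    case False
    then obtain s where "s \<in> S" by blast
    then show ?thesis by (intro exI[of _ "{s}"]) auto
  qed auto
next
  case (insert f A)
  obtain B where B: "B \<subseteq> S" "finite B" "\<And>s. s \<in> S \<Longrightarrow> \<exists>b\<in>B. \<forall>g\<in>A. g b \<le> g s"
    using insert.IH[of S] by blast
  have "\<forall>t. \<exists>C\<subseteq>{s\<in>S. f s = t}. finite C \<and> (\<forall>s\<in>{s\<in>S. f s = t}. \<exists>b\<in>C. \<forall>g\<in>A. g b \<le> g s)"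
    using insert.IH by blast
  from choice[OF this] obtain C where C': "\<forall>t. C t \<subseteq> {s\<in>S. f s = t} \<and> finite (C t) \<and>
      (\<forall>s\<in>{s\<in>S. f s = t}. \<exists>b\<in>C t. \<forall>g\<in>A. g b \<le> g s)" ..
  then have C: "\<And>t. C t \<subseteq> {s\<in>S. f s = t}" "\<And>t. finite (C t)"
      "\<And>t s. s \<in> S \<Longrightarrow> f s = t \<Longrightarrow> \<exists>b\<in>C t. \<forall>g\<in>A. g b \<le> g s"
    by blast+
  \<comment> \<open>Where \<open>f\<close> is at least \<open>N\<close>, the representatives in
    \<open>B\<close> are also small enough for \<open>f\<close>. Below \<open>N\<close> there are
    finitely many slices of constant \<open>f\<close>, each with its own representatives
    \<open>C t\<close>.\<close>
  define N where "N = (\<Sum>b\<in>B. f b)"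
  have N: "f b \<le> N" if "b \<in> B" for b
    unfolding N_def using B(2) that by (simp add: member_le_sum)
  have "\<exists>b\<in>B \<union> (\<Union>t<N. C t). \<forall>g\<in>insert f A. g b \<le> g s" if s: "s \<in> S" for s
  proof (cases "f s < N")
    case True
    obtain b where "b \<in> C (f s)" "\<forall>g\<in>A. g b \<le> g s" using C(3)[OF s refl] by blast
    then show ?thesis using True C(1)[of "f s"] by (intro bexI[of _ b]) auto
  next
    case False
    obtain b where "b \<in> B" "\<forall>g\<in>A. g b \<le> g s" using B(3)[OF s] by blast
    then show ?thesis using False N[of b] by (intro bexI[of _ b]) auto
  qed
  then show ?case
    using B(1,2) C(1,2) by (intro exI[of _ "B \<union> (\<Union>t<N. C t)"] conjI) (blast, blast, blast)
qed

definition monom_degree :: "('n::finite \<Rightarrow>\<^sub>0 nat) \<Rightarrow> nat" where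
  "monom_degree m = (\<Sum>i\<in>UNIV. Poly_Mapping.lookup m i)"

lemma monom_degree_add: "monom_degree (u + v) = monom_degree u + monom_degree v"
  by (simp add: monom_degree_def lookup_add sum.distrib)

text \<open>Monomials of the free module are ordered by a numerical code, a product of prime powers:
  this makes the order a well-order and compatible with multiplication for free.\<close>

lemma monomial_code_exists:
  "\<exists>(code :: 'q::finite \<times> ('n::finite \<Rightarrow>\<^sub>0 nat) \<Rightarrow> nat) w. inj code \<and>
     (\<forall>j u m. code (j, u + m) = w u * code (j, m))"
proof -
  \<comment> \<open>One prime is attached to each variable and one to each component; the component
    of a monomial is recorded by exponent 1 at its prime.\<close>
  obtain h :: "'n + 'q \<Rightarrow> nat" where h: "inj h"
    using finite_imp_inj_to_nat_seg[OF finite_class.finite_UNIV] by blast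
  obtain e :: "nat \<Rightarrow> nat" where e: "inj e" "range e \<subseteq> {p. prime p}"
    using infinite_countable_subset[OF primes_infinite] by blast
  define pr where "pr = e \<circ> h"
  have inj: "inj pr" and prime: "prime (pr i)" for i
    using h e by (auto simp: pr_def inj_compose image_subset_iff)
  define ex :: "'q \<times> ('n \<Rightarrow>\<^sub>0 nat) \<Rightarrow> 'n + 'q \<Rightarrow> nat" where
    "ex t i = (case i of Inl k \<Rightarrow> Poly_Mapping.lookup (snd t) k | Inr j \<Rightarrow> of_bool (j = fst t))" for t i
  define code where "code t = (\<Prod>i\<in>UNIV. pr i ^ ex t i)" for t
  define w where "w u = (\<Prod>i\<in>UNIV. pr (Inl i) ^ Poly_Mapping.lookup u i)" for u
  \<comment> \<open>Unique factorisation recovers all exponents, hence the monomial, from its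
    code.\<close>
  have mult: "multiplicity (pr i) (code t) = ex t i" for i t
  proof -
    have "code t = (\<Prod>p\<in>range pr. p ^ (ex t (inv pr p)))"
      using inj by (simp add: code_def prod.reindex)
    then show ?thesis
      using multiplicity_prod_prime_powers[of "range pr" "pr i" "\<lambda>p. ex t (inv pr p)"] prime inj
      by auto
  qed
  have "inj code"
  proof (rule injI)
    fix s t assume "code s = code t"
    then have *: "ex s i = ex t i" for i
      using mult by metis
    have "snd s = snd t"
      by (rule poly_mapping_eqI) (use *[of "Inl _"] in \<open>simp add: ex_def\<close>)
    moreover have "fst s = fst t"
      using *[of "Inr (fst s)"] by (simp add: ex_def of_bool_def split: if_splits)
    ultimately show "s = t" by (simp add: prod_eq_iff)
  qed
  moreover have "code (j, u + m) = w u * code (j, m)" for j u m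
  proof -
    have split: "code t = (\<Prod>i\<in>UNIV. pr (Inl i) ^ Poly_Mapping.lookup (snd t) i) * (\<Prod>j\<in>UNIV. pr (Inr j) ^ of_bool (j = fst t))" for t
      unfolding code_def using prod.Plus[of "UNIV :: 'n set" "UNIV :: 'q set" "\<lambda>i. pr i ^ ex t i"]
      by (simp add: ex_def)
    show ?thesis
      by (simp add: split w_def lookup_add power_add prod.distrib)
  qed
  ultimately show ?thesis by blast
qed

section \<open>Monomials and order of vanishing in the free module\<close>

lemma lookup_single_mult_add:
  fixes p :: "('n \<Rightarrow>\<^sub>0 nat) \<Rightarrow>\<^sub>0 'a::semiring_0"
  shows "Poly_Mapping.lookup (Poly_Mapping.single u c * p) (u + m) = c * Poly_Mapping.lookup p m"
proof (induction p rule: poly_mapping_single_induct)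
  case (single m' c')
  then show ?case by (simp add: mult_single lookup_single when_def)
qed (simp_all add: lookup_add ring_distribs)

lemma keys_single_mult:
  fixes p :: "('n \<Rightarrow>\<^sub>0 nat) \<Rightarrow>\<^sub>0 'a::semiring_0"
  shows "Poly_Mapping.keys (Poly_Mapping.single u c * p) \<subseteq> (+) u ` Poly_Mapping.keys p"
  using keys_mult[of "Poly_Mapping.single u c" p] by (auto split: if_splits)

definition vterms :: "'n diffop ^ 'q \<Rightarrow> ('q \<times> ('n \<Rightarrow>\<^sub>0 nat)) set" where
  "vterms p = {(j, m). m \<in> Poly_Mapping.keys (p $ j)}"

lemma finite_vterms: "finite (vterms (p :: 'n diffop ^ 'q::finite))"
proof -
  have "vterms p = (\<Union>j. Pair j ` Poly_Mapping.keys (p $ j))"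
    by (auto simp: vterms_def)
  then show ?thesis by simp
qed

lemma vterms_eq_empty_iff: "vterms p = {} \<longleftrightarrow> p = 0"
  by (auto simp: vterms_def vec_eq_iff in_keys_iff poly_mapping_eq_iff fun_eq_iff)

lemma vterms_diff: "vterms (p - q) \<subseteq> vterms p \<union> vterms q"
  by (auto simp: vterms_def in_keys_iff lookup_minus)

lemma vterms_single_mult: "vterms (Poly_Mapping.single u c *s p) \<subseteq> (\<lambda>(j, m). (j, u + m)) ` vterms p"
  using keys_single_mult by (fastforce simp: vterms_def)

text \<open>Membership in the \<open>k\<close>-th power of the maximal ideal of the origin times the
  free module, read off the exponents.\<close>

definition order_ge :: "nat \<Rightarrow> ('n::finite) diffop ^ 'q \<Rightarrow> bool" where
  "order_ge k p \<longleftrightarrow> (\<forall>(j, m)\<in>vterms p. k \<le> monom_degree m)"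

lemma order_ge_0 [simp]: "order_ge 0 p"
  by (simp add: order_ge_def)

lemma order_ge_zero [simp]: "order_ge k 0"
  by (simp add: order_ge_def vterms_def)

lemma order_ge_diff: "order_ge k p \<Longrightarrow> order_ge k q \<Longrightarrow> order_ge k (p - q)"
  using vterms_diff[of p q] unfolding order_ge_def by blast

text \<open>The leading monomial records the monomial with the largest code, whereas the order is the lowest
  degree of a monomial. The last function in the application of Dickson's lemma below makes a
  reduction step preserve the order.\<close>

lemma artin_rees:
  fixes L :: "('n::finite diffop ^ 'q::finite) set"
  assumes L: "diffop_free.subspace L"
  obtains G N where "finite G" "G \<subseteq> L" "L \<subseteq> diffop_free.span G"
    "\<And>p. p \<in> L \<Longrightarrow> order_ge N p \<Longrightarrow> \<exists>s. p = (\<Sum>g\<in>G. s g *s g) \<and> (\<forall>g. Poly_Mapping.lookup (s g) 0 = 0)"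
proof -
  obtain code :: "'q \<times> ('n \<Rightarrow>\<^sub>0 nat) \<Rightarrow> nat" and w
    where inj: "inj code" and code: "\<And>j u m. code (j, u + m) = w u * code (j, m)"
    using monomial_code_exists by blast
  have "\<exists>t. p \<noteq> 0 \<longrightarrow> t \<in> vterms p \<and> (\<forall>s\<in>vterms p. code s \<le> code t)" for p
  proof (cases "p = 0")
    case False
    then have "Max (code ` vterms p) \<in> code ` vterms p"
      by (intro Max_in) (simp_all add: vterms_eq_empty_iff finite_vterms)
    then obtain t where "t \<in> vterms p" "Max (code ` vterms p) = code t" by blast
    then show ?thesis using finite_vterms[of p] by (metis Max_ge finite_imageI imageI)
  qed simp
  then have "\<exists>lt. \<forall>p. p \<noteq> 0 \<longrightarrow> lt p \<in> vterms p \<and> (\<forall>s\<in>vterms p. code s \<le> code (lt p))"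
    by (intro choice allI)
  then obtain lt where "\<forall>p. p \<noteq> 0 \<longrightarrow> lt p \<in> vterms p \<and> (\<forall>s\<in>vterms p. code s \<le> code (lt p))" ..
  then have lt: "lt p \<in> vterms p" "\<And>t. t \<in> vterms p \<Longrightarrow> code t \<le> code (lt p)" if "p \<noteq> 0" for p
    using that by blast+
  define ord :: "'n diffop ^ 'q \<Rightarrow> nat" where "ord p = Min ((monom_degree \<circ> snd) ` vterms p)" for p
  have ord: "order_ge k p \<longleftrightarrow> k \<le> ord p" if "p \<noteq> 0" for k p
  proof -
    have "vterms p \<noteq> {}" using that by (simp add: vterms_eq_empty_iff)
    then show ?thesis
      using finite_vterms[of p] by (auto simp: ord_def order_ge_def)
  qed
  have ord_lt: "ord p \<le> monom_degree (snd (lt p))" if "p \<noteq> 0" for p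
    using lt(1)[OF that] finite_vterms[of p] unfolding ord_def by (intro Min_le) auto
  \<comment> \<open>Comparing exponents yields divisibility of leading monomials, and comparing the
    indicators forces equal components. The last function is the excess of the leading degree over
    the order.\<close>
  define A :: "('n diffop ^ 'q \<Rightarrow> nat) set" where
    "A = range (\<lambda>i p. Poly_Mapping.lookup (snd (lt p)) i) \<union> range (\<lambda>j p. of_bool (fst (lt p) = j))
       \<union> {ord, \<lambda>p. monom_degree (snd (lt p)) - ord p}"
  have "finite A" by (simp add: A_def)
  from dickson[OF this, of "L - {0}"]
  obtain G where G: "G \<subseteq> L - {0}" "finite G" "\<And>p. p \<in> L - {0} \<Longrightarrow> \<exists>g\<in>G. \<forall>f\<in>A. f g \<le> f p"
    by blast
  \<comment> \<open>An upper bound for the orders of the generators. Once an element has larger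
    order, every monomial multiplier in its reduction has positive degree, so the coefficients
    vanish at the origin.\<close>
  define N where "N = (\<Sum>g\<in>G. ord g)"
  have N: "ord g \<le> N" if "g \<in> G" for g
    unfolding N_def using G(2) that by (simp add: member_le_sum)
  \<comment> \<open>The target \<open>V\<close> is left abstract so that one division serves twice:
    \<open>k = 0\<close> gives generation by \<open>G\<close>, and \<open>k = Suc N\<close> gives
    coefficients without constant term. The induction is on a bound for the codes, since each
    reduction lowers the leading one.\<close>
  have main: "p \<in> V" if V: "0 \<in> V" "\<And>x y. x \<in> V \<Longrightarrow> y \<in> V \<Longrightarrow> x + y \<in> V"
      "\<And>g u c. g \<in> G \<Longrightarrow> (k > N \<longrightarrow> u \<noteq> 0) \<Longrightarrow> Poly_Mapping.single u c *s g \<in> V"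
      and p: "p \<in> L" "order_ge k p" "\<forall>t\<in>vterms p. code t < n" for p V k n
    using p
  proof (induction n arbitrary: p rule: less_induct)
    case (less n)
    show ?case
    proof (cases "p = 0")
      case False
      then obtain g where g: "g \<in> G" "\<And>f. f \<in> A \<Longrightarrow> f g \<le> f p"
        using G(3) less.prems(1) by blast
      have "g \<noteq> 0" "g \<in> L" using g(1) G(1) by auto
      obtain j v where pv: "lt p = (j, v)" by fastforce
      obtain j' v' where gv': "lt g = (j', v')" by fastforce
      have "of_bool (j' = j') \<le> (of_bool (j = j') :: nat)"
        using g(2)[of "\<lambda>p. of_bool (fst (lt p) = j')"] by (auto simp: A_def pv gv')
      then have "j' = j" by (cases "j = j'") simp_all
      then have gv: "lt g = (j, v')" using gv' by simp
      have le: "Poly_Mapping.lookup v' i \<le> Poly_Mapping.lookup v i" for i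
        using g(2)[of "\<lambda>p. Poly_Mapping.lookup (snd (lt p)) i"] by (auto simp: A_def pv gv)
      define u where "u = v - v'"
      have v: "v = u + v'"
        by (rule poly_mapping_eqI) (simp add: u_def lookup_add lookup_minus le)
      have o1: "ord g \<le> ord p" using g(2)[of ord] by (simp add: A_def)
      have o2: "monom_degree v' - ord g \<le> monom_degree v - ord p"
        using g(2)[of "\<lambda>p. monom_degree (snd (lt p)) - ord p"] by (simp add: A_def pv gv)
      have o3: "ord g \<le> monom_degree v'" "ord p \<le> monom_degree v"
        using ord_lt[OF \<open>g \<noteq> 0\<close>] ord_lt[OF False] by (simp_all add: pv gv)
      have o4: "k \<le> ord p" using less.prems(2) ord[OF False] by simp
      have dv: "monom_degree v = monom_degree u + monom_degree v'"
        by (simp add: v monom_degree_add)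
      \<comment> \<open>As \<open>u\<close> has degree deg v - deg v', comparing the excesses of
        \<open>g\<close> and \<open>p\<close> says that the order of \<open>g\<close> plus the
        degree of \<open>u\<close> is at least the order of \<open>p\<close>.\<close>
      have ou: "k \<le> monom_degree u + ord g"
        using o1 o2 o3 o4 dv by linarith
      have upos: "k > N \<longrightarrow> u \<noteq> 0"
        using ou N[OF g(1)] by (auto simp: monom_degree_def)
      define c where "c = Poly_Mapping.lookup (p $ j) v / Poly_Mapping.lookup (g $ j) v'"
      define h where "h = Poly_Mapping.single u c *s g"
      have hV: "h \<in> V" unfolding h_def using V(3)[OF g(1) upos] .
      have hL: "h \<in> L" unfolding h_def using L \<open>g \<in> L\<close> by (rule diffop_free.subspace_scale)
      have hord: "order_ge k h"
      proof -
        have "order_ge (ord g) g" using ord[OF \<open>g \<noteq> 0\<close>] by simp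
        then show ?thesis
          using vterms_single_mult[of u c g] ou unfolding order_ge_def h_def
          by (fastforce simp: monom_degree_add)
      qed
      have hcode: "code t \<le> code (j, v)" if "t \<in> vterms h" for t
      proof -
        obtain i m where t: "t = (i, u + m)" "(i, m) \<in> vterms g"
          using \<open>t \<in> vterms h\<close> vterms_single_mult[of u c g] unfolding h_def by auto
        then have "code (i, m) \<le> code (j, v')" using lt(2)[OF \<open>g \<noteq> 0\<close>] gv by auto
        then show ?thesis by (simp add: t v code)
      qed
      have top: "Poly_Mapping.lookup ((p - h) $ j) v = 0"
      proof -
        have "Poly_Mapping.lookup (g $ j) v' \<noteq> 0"
          using lt(1)[OF \<open>g \<noteq> 0\<close>] gv by (auto simp: vterms_def in_keys_iff)
        then show ?thesis
          unfolding h_def by (simp add: lookup_minus v lookup_single_mult_add c_def)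
      qed
      have "\<forall>t\<in>vterms (p - h). code t < code (j, v)"
      proof
        fix t assume t: "t \<in> vterms (p - h)"
        then have "t \<in> vterms p \<union> vterms h" using vterms_diff by blast
        then have "code t \<le> code (j, v)" using hcode[of t] lt(2)[OF False, of t] pv by auto
        moreover have "t \<noteq> (j, v)" using t top by (auto simp: vterms_def in_keys_iff)
        ultimately show "code t < code (j, v)" using inj by (metis injD le_neq_implies_less)
      qed
      moreover have "code (j, v) < n" using lt(1)[OF False] less.prems(3) pv by auto
      ultimately have "p - h \<in> V"
        using less.IH[of "code (j, v)" "p - h"] diffop_free.subspace_diff[OF L less.prems(1) hL]
          order_ge_diff[OF less.prems(2) hord] by blast
      then show ?thesis using V(2)[OF _ hV, of "p - h"] by simp
    qed (simp add: V)
  qed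
  have bound: "\<exists>n. \<forall>t\<in>vterms p. code t < n" for p
    using finite_vterms[of p] by (metis finite_imageI finite_nat_set_iff_bounded imageI)
  show thesis
  proof (rule that[of G "Suc N"])
    show "finite G" "G \<subseteq> L" using G by auto
    show "L \<subseteq> diffop_free.span G"
    proof
      fix p assume p: "p \<in> L"
      obtain n where n: "\<forall>t\<in>vterms p. code t < n" using bound by blast
      show "p \<in> diffop_free.span G"
        by (rule main[OF _ _ _ p order_ge_0 n])
          (auto intro: diffop_free.span_zero diffop_free.span_add diffop_free.span_scale diffop_free.span_base)
    qed
    fix p assume p: "p \<in> L" "order_ge (Suc N) p"
    obtain n where n: "\<forall>t\<in>vterms p. code t < n" using bound by blast
    define V where "V = {(\<Sum>g\<in>G. s g *s g) |s. \<forall>g. Poly_Mapping.lookup (s g) 0 = 0}"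
    have VI: "(\<Sum>g\<in>G. s g *s g) \<in> V" if "\<And>g. Poly_Mapping.lookup (s g) 0 = 0" for s
      unfolding V_def using that by blast
    have "p \<in> V"
    proof (rule main[OF _ _ _ p n])
      show "0 \<in> V" using VI[of "\<lambda>_. 0"] by simp
    next
      fix x y assume "x \<in> V" "y \<in> V"
      then obtain s t where st: "x = (\<Sum>g\<in>G. s g *s g)" "y = (\<Sum>g\<in>G. t g *s g)"
        "\<forall>g. Poly_Mapping.lookup (s g) 0 = 0" "\<forall>g. Poly_Mapping.lookup (t g) 0 = 0"
        unfolding V_def by blast
      then have "x + y = (\<Sum>g\<in>G. (s g + t g) *s g)"
        by (simp only: diffop_free.scale_left_distrib sum.distrib)
      then show "x + y \<in> V" using VI[of "\<lambda>g. s g + t g"] st by (simp add: lookup_add)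
    next
      fix g and u and c :: complex assume g: "g \<in> G" "N < Suc N \<longrightarrow> (u :: 'n \<Rightarrow>\<^sub>0 nat) \<noteq> 0"
      define s where "s h = (if h = g then Poly_Mapping.single u c else 0 :: 'n diffop)" for h
      have "(\<Sum>h\<in>G. s h *s h) = (\<Sum>h\<in>{g}. s h *s h)"
        using G(2) g(1) by (intro sum.mono_neutral_right) (auto simp: s_def)
      then have "Poly_Mapping.single u c *s g = (\<Sum>h\<in>G. s h *s h)" by (simp add: s_def)
      then show "Poly_Mapping.single u c *s g \<in> V"
        using VI[of s] g(2) by (simp add: s_def lookup_single when_def)
    qed
    then show "\<exists>s. p = (\<Sum>g\<in>G. s g *s g) \<and> (\<forall>g. Poly_Mapping.lookup (s g) 0 = 0)"
      unfolding V_def by blast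
  qed
qed

text \<open>Artin-Rees for L = D x + M puts some \<open>x - m\<close> into the maximal ideal times
  L. Modulo \<open>M\<close> every generator of L is a multiple of the single element
  \<open>x\<close>, so collecting coefficients gives \<open>x - m = t *s x + n\<close> with
  \<open>t\<close> vanishing at the origin, and \<open>1 - t\<close> is the operator sought; no
  determinant has to be formed.\<close>

lemma krull_intersection:
  fixes M :: "('n::finite diffop ^ 'q::finite) set"
  assumes M: "diffop_free.subspace M"
    and x: "\<And>k. \<exists>m\<in>M. order_ge k (x - m)"
  shows "\<exists>r. Poly_Mapping.lookup r 0 = 1 \<and> r *s x \<in> M"
proof -
  define L where "L = {r *s x + m |r m. m \<in> M}"
  have L: "diffop_free.subspace L"
    unfolding diffop_free.subspace_def
  proof (intro conjI ballI allI)
    show "0 \<in> L" unfolding L_def using diffop_free.subspace_0[OF M]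
      by (auto intro!: exI[of _ 0])
  next
    fix y z assume "y \<in> L" "z \<in> L"
    then obtain r m r' m' where "y = r *s x + m" "m \<in> M" "z = r' *s x + m'" "m' \<in> M"
      unfolding L_def by blast
    then have "y + z = (r + r') *s x + (m + m')" "m + m' \<in> M"
      using diffop_free.subspace_add[OF M] by (auto simp: diffop_free.scale_left_distrib)
    then show "y + z \<in> L" unfolding L_def by blast
  next
    fix s y assume "y \<in> L"
    then obtain r m where "y = r *s x + m" "m \<in> M" unfolding L_def by blast
    then have "s *s y = (s * r) *s x + s *s m" "s *s m \<in> M"
      using diffop_free.subspace_scale[OF M] by (auto simp: diffop_free.scale_right_distrib)
    then show "s *s y \<in> L" unfolding L_def by blast
  qed
  obtain G N where G: "finite G" "G \<subseteq> L"
    "\<And>p. p \<in> L \<Longrightarrow> order_ge N p \<Longrightarrow> \<exists>s. p = (\<Sum>g\<in>G. s g *s g) \<and> (\<forall>g. Poly_Mapping.lookup (s g) 0 = 0)"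
    by (rule artin_rees[OF L]) (rule that)
  obtain m where m: "m \<in> M" "order_ge N (x - m)" using x by blast
  have "x - m = 1 *s x + (- m)" by simp
  then have "x - m \<in> L" unfolding L_def using m(1) diffop_free.subspace_neg[OF M] by blast
  from G(3)[OF this m(2)] obtain s where
    s: "x - m = (\<Sum>g\<in>G. s g *s g)" "\<forall>g. Poly_Mapping.lookup (s g) 0 = 0" by blast
  have "\<forall>g\<in>G. \<exists>r m. g = r *s x + m \<and> m \<in> M" using G(2) unfolding L_def by blast
  then obtain r m' where r: "\<And>g. g \<in> G \<Longrightarrow> g = r g *s x + m' g" "\<And>g. g \<in> G \<Longrightarrow> m' g \<in> M"
    by metis
  define t where "t = (\<Sum>g\<in>G. s g * r g)"
  define n where "n = (\<Sum>g\<in>G. s g *s m' g)"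
  have "(\<Sum>g\<in>G. s g *s g) = (\<Sum>g\<in>G. (s g * r g) *s x + s g *s m' g)"
  proof (rule sum.cong)
    fix g assume "g \<in> G"
    then have "s g *s g = s g *s (r g *s x + m' g)" using r(1) by simp
    then show "s g *s g = (s g * r g) *s x + s g *s m' g"
      by (simp only: diffop_free.scale_right_distrib diffop_free.scale_scale)
  qed simp
  also have "\<dots> = t *s x + n"
    by (simp only: sum.distrib t_def n_def diffop_free.scale_sum_left)
  finally have "(1 - t) *s x = m + n"
    using s(1) by (simp add: algebra_simps)
  moreover have "n \<in> M"
    unfolding n_def using r(2) by (intro diffop_free.subspace_sum[OF M] diffop_free.subspace_scale[OF M])
  then have "m + n \<in> M" using m(1) diffop_free.subspace_add[OF M] by blast
  moreover have "Poly_Mapping.lookup (1 - t) 0 = 1"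
    using s(2) by (simp add: t_def lookup_minus lookup_sum lookup_mult_zero_nat)
  ultimately show ?thesis by metis
qed

section \<open>Partial derivatives of signals\<close>

definition expo :: "real ^ 'n::finite \<Rightarrow> real ^ 'n \<Rightarrow> complex" where
  "expo a x = exp (\<i> * complex_of_real (a \<bullet> x))"

lemma expo_add: "expo (a + b) x = expo a x * expo b x"
  by (simp add: expo_def inner_add_left ring_distribs exp_add)

lemma expo_at_0 [simp]: "expo a 0 = 1"
  by (simp add: expo_def)

text \<open>\<open>vector_derivative\<close> carries information only where a derivative exists, so
  the sum and product rules for \<open>D_partial\<close> are tied to this class.\<close>

definition partially_diff :: "(real ^ 'n::finite \<Rightarrow> complex) \<Rightarrow> bool" where
  "partially_diff f \<longleftrightarrow> (\<forall>j x. (\<lambda>t. f (x + t *\<^sub>R axis j 1)) differentiable (at (0::real)))"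

lemma D_partial_eqI:
  "((\<lambda>t. f (x + t *\<^sub>R axis j 1)) has_vector_derivative \<i> * d) (at 0) \<Longrightarrow> D_partial j f x = d"
  by (simp add: D_partial_def vector_derivative_at)

lemma has_D_partial:
  "partially_diff f \<Longrightarrow>
    ((\<lambda>t. f (x + t *\<^sub>R axis j 1)) has_vector_derivative \<i> * D_partial j f x) (at 0)"
  by (simp add: partially_diff_def D_partial_def vector_derivative_works)

lemma partially_diffI:
  "(\<And>j x. ((\<lambda>t. f (x + t *\<^sub>R axis j 1)) has_vector_derivative d j x) (at 0)) \<Longrightarrow> partially_diff f"
  unfolding partially_diff_def by (blast intro: differentiableI_vector)

lemma partially_diff_plus:
  assumes "partially_diff f" "partially_diff g"
  shows "partially_diff (\<lambda>x. f x + g x)"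
    and "D_partial j (\<lambda>x. f x + g x) = (\<lambda>x. D_partial j f x + D_partial j g x)"
proof -
  have *: "((\<lambda>t. f (x + t *\<^sub>R axis j 1) + g (x + t *\<^sub>R axis j 1)) has_vector_derivative
     \<i> * (D_partial j f x + D_partial j g x)) (at 0)" for j x
    using has_vector_derivative_add[OF has_D_partial[OF assms(1)] has_D_partial[OF assms(2)]]
    by (simp add: ring_distribs)
  show "partially_diff (\<lambda>x. f x + g x)" by (rule partially_diffI) (rule *)
  show "D_partial j (\<lambda>x. f x + g x) = (\<lambda>x. D_partial j f x + D_partial j g x)"
    by (rule ext, rule D_partial_eqI) (rule *)
qed

lemma partially_diff_times:
  assumes "partially_diff f" "partially_diff g"
  shows "partially_diff (\<lambda>x. f x * g x)"
    and "D_partial j (\<lambda>x. f x * g x) = (\<lambda>x. D_partial j f x * g x + f x * D_partial j g x)"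
proof -
  have *: "((\<lambda>t. f (x + t *\<^sub>R axis j 1) * g (x + t *\<^sub>R axis j 1)) has_vector_derivative
     \<i> * (D_partial j f x * g x + f x * D_partial j g x)) (at 0)" for j x
    using has_vector_derivative_mult[OF has_D_partial[OF assms(1)] has_D_partial[OF assms(2)], of x j x j]
    by (simp add: algebra_simps)
  show "partially_diff (\<lambda>x. f x * g x)" by (rule partially_diffI) (rule *)
  show "D_partial j (\<lambda>x. f x * g x) = (\<lambda>x. D_partial j f x * g x + f x * D_partial j g x)"
    by (rule ext, rule D_partial_eqI) (rule *)
qed

lemma partially_diff_coord:
  fixes k :: "'n::finite"
  shows "partially_diff (\<lambda>x :: real ^ 'n. complex_of_real (x $ k))"
    and "D_partial j (\<lambda>x :: real ^ 'n. complex_of_real (x $ k)) = (\<lambda>x. if j = k then - \<i> else 0)"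
proof -
  have *: "((\<lambda>t. complex_of_real ((x + t *\<^sub>R axis j 1) $ k)) has_vector_derivative
     \<i> * (if j = k then - \<i> else 0)) (at 0)" for j and x :: "real ^ 'n"
  proof -
    have "((\<lambda>t. complex_of_real (x $ k + t * (if k = j then 1 else 0))) has_vector_derivative
      of_real (if k = j then 1 else 0)) (at 0)"
      by (rule has_vector_derivative_of_real) (auto intro!: derivative_eq_intros)
    then show ?thesis by (auto simp: axis_def)
  qed
  show "partially_diff (\<lambda>x :: real ^ 'n. complex_of_real (x $ k))" by (rule partially_diffI) (rule *)
  show "D_partial j (\<lambda>x :: real ^ 'n. complex_of_real (x $ k)) = (\<lambda>x. if j = k then - \<i> else 0)"
    by (rule ext, rule D_partial_eqI) (rule *)
qed

lemma partially_diff_expo_sum: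
  shows "partially_diff (\<lambda>x. \<Sum>a\<in>A. c a * expo a x)"
    and "D_partial j (\<lambda>x. \<Sum>a\<in>A. c a * expo a x) = (\<lambda>x. \<Sum>a\<in>A. (complex_of_real (a $ j) * c a) * expo a x)"
proof -
  have *: "((\<lambda>t. \<Sum>a\<in>A. c a * expo a (x + t *\<^sub>R axis j 1)) has_vector_derivative
     \<i> * (\<Sum>a\<in>A. (complex_of_real (a $ j) * c a) * expo a x)) (at 0)" for j x
  proof -
    have 1: "((\<lambda>t. \<i> * complex_of_real (a \<bullet> (x + t *\<^sub>R axis j 1))) has_vector_derivative \<i> * complex_of_real (a $ j)) (at 0)" for a
    proof -
      have "((\<lambda>t. complex_of_real (a \<bullet> x + t * (a $ j))) has_vector_derivative of_real (a $ j)) (at 0)"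
        by (rule has_vector_derivative_of_real) (auto intro!: derivative_eq_intros)
      from has_vector_derivative_mult_right[OF this, of \<i>] show ?thesis
        by (simp add: inner_add_right inner_axis)
    qed
    have 2: "((\<lambda>t. expo a (x + t *\<^sub>R axis j 1)) has_vector_derivative \<i> * complex_of_real (a $ j) * expo a x) (at 0)" for a
      using field_vector_diff_chain_at[OF 1 DERIV_exp] by (simp add: expo_def o_def)
    have "((\<lambda>t. \<Sum>a\<in>A. c a * expo a (x + t *\<^sub>R axis j 1)) has_vector_derivative
       (\<Sum>a\<in>A. c a * (\<i> * complex_of_real (a $ j) * expo a x))) (at 0)"
      by (intro has_vector_derivative_sum has_vector_derivative_mult_right 2)
    then show ?thesis by (simp add: sum_distrib_left mult_ac)
  qed
  show "partially_diff (\<lambda>x. \<Sum>a\<in>A. c a * expo a x)" by (rule partially_diffI) (rule *)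
  show "D_partial j (\<lambda>x. \<Sum>a\<in>A. c a * expo a x) = (\<lambda>x. \<Sum>a\<in>A. (complex_of_real (a $ j) * c a) * expo a x)"
    by (rule ext, rule D_partial_eqI) (rule *)
qed

lemma PT_fin_iff: "f \<in> PT_fin \<longleftrightarrow> (\<exists>A c. finite A \<and> A \<subseteq> rat_points \<and> f = (\<lambda>x. \<Sum>a\<in>A. c a * expo a x))"
  by (simp add: PT_fin_def expo_def)

lemma expo_in_PT_fin_poly: "a \<in> rat_points \<Longrightarrow> (\<lambda>x. c * expo a x) \<in> PT_fin_poly"
  by (rule PT_fin_poly.base, unfold PT_fin_iff, rule exI[of _ "{a}"], rule exI[of _ "\<lambda>_. c"]) simp

lemma zero_in_rat_points: "0 \<in> rat_points"
  by (simp add: rat_points_def)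

lemma const_in_PT_fin_poly: "(\<lambda>x. c) \<in> PT_fin_poly"
  using expo_in_PT_fin_poly[OF zero_in_rat_points, of c] by (simp add: expo_def)

lemma scale_in_PT_fin_poly: "f \<in> PT_fin_poly \<Longrightarrow> (\<lambda>x. c * f x) \<in> PT_fin_poly"
  by (rule PT_fin_poly.times[OF const_in_PT_fin_poly])

lemma sum_in_PT_fin_poly:
  "(\<And>i. i \<in> I \<Longrightarrow> f i \<in> PT_fin_poly) \<Longrightarrow> (\<lambda>x. \<Sum>i\<in>I. f i x) \<in> PT_fin_poly"
proof (induction I rule: infinite_finite_induct)
  case (insert i I)
  then show ?case by (simp add: PT_fin_poly.plus)
qed (simp_all add: const_in_PT_fin_poly)

lemma PT_fin_poly_partially_diff: "f \<in> PT_fin_poly \<Longrightarrow> partially_diff f"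
proof (induction rule: PT_fin_poly.induct)
  case (base f)
  then show ?case unfolding PT_fin_iff by (auto intro: partially_diff_expo_sum)
qed (auto intro: partially_diff_coord partially_diff_plus partially_diff_times)

lemmas D_partial_plus = partially_diff_plus(2)[OF PT_fin_poly_partially_diff PT_fin_poly_partially_diff]
lemmas D_partial_times = partially_diff_times(2)[OF PT_fin_poly_partially_diff PT_fin_poly_partially_diff]
lemmas D_partial_coord = partially_diff_coord(2)

lemma D_partial_expo: "D_partial j (expo a) = (\<lambda>x. complex_of_real (a $ j) * expo a x)"
  using partially_diff_expo_sum(2)[of j "\<lambda>_. 1" "{a}"] by simp

lemma D_partial_const [simp]: "D_partial j (\<lambda>x. c) = (\<lambda>x. 0)"
  by (rule ext, rule D_partial_eqI) simp

lemma D_partial_scale: "f \<in> PT_fin_poly \<Longrightarrow> D_partial j (\<lambda>x. c * f x) = (\<lambda>x. c * D_partial j f x)"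
  by (simp add: D_partial_times const_in_PT_fin_poly)

text \<open>This takes the place of smoothness: derivatives of every order exist because a
  derivative of a signal is again a signal.\<close>

lemma D_partial_in_PT_fin_poly: "f \<in> PT_fin_poly \<Longrightarrow> D_partial j f \<in> PT_fin_poly"
proof (induction rule: PT_fin_poly.induct)
  case (base f)
  then obtain A c where A: "finite A" "A \<subseteq> rat_points" "f = (\<lambda>x. \<Sum>a\<in>A. c a * expo a x)"
    unfolding PT_fin_iff by blast
  have "D_partial j f \<in> PT_fin"
    unfolding PT_fin_iff A(3) partially_diff_expo_sum(2) using A(1,2)
    by (intro exI[of _ A] exI[of _ "\<lambda>a. complex_of_real (a $ j) * c a"]) simp
  then show ?case by (rule PT_fin_poly.base)
next
  case (coord k)
  show ?case unfolding D_partial_coord by (rule const_in_PT_fin_poly)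
next
  case (plus f g)
  then show ?case by (simp add: D_partial_plus PT_fin_poly.plus)
next
  case (times f g)
  then show ?case by (simp add: D_partial_times PT_fin_poly.plus PT_fin_poly.times)
qed

text \<open>The commutator of two derivations is a derivation, so it vanishes on the signal algebra
  once it vanishes on the generators.\<close>

lemma D_partial_commute:
  "f \<in> PT_fin_poly \<Longrightarrow> D_partial j (D_partial k f) = D_partial k (D_partial j f)"
proof (induction rule: PT_fin_poly.induct)
  case (base f)
  then obtain A c where f: "f = (\<lambda>x. \<Sum>a\<in>A. c a * expo a x)"
    unfolding PT_fin_iff by blast
  show ?case unfolding f partially_diff_expo_sum(2) by (simp add: mult_ac)
next
  case (coord i)
  show ?case by (simp add: D_partial_coord)
next
  case (plus f g)
  then show ?case by (simp add: D_partial_plus D_partial_in_PT_fin_poly)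
next
  case (times f g)
  then show ?case
    by (simp add: D_partial_times D_partial_plus D_partial_in_PT_fin_poly PT_fin_poly.times add_ac)
qed

section \<open>Signals as a module over the differential operators\<close>

lemma D_partial_funpow_in: "f \<in> PT_fin_poly \<Longrightarrow> (D_partial j ^^ n) f \<in> PT_fin_poly"
  by (induction n) (simp_all add: D_partial_in_PT_fin_poly)

lemma D_partial_funpow_commute:
  assumes "f \<in> PT_fin_poly"
  shows "(D_partial j ^^ m) ((D_partial k ^^ n) f) = (D_partial k ^^ n) ((D_partial j ^^ m) f)"
proof -
  have *: "D_partial j ((D_partial k ^^ n) f) = (D_partial k ^^ n) (D_partial j f)" if "f \<in> PT_fin_poly" for f j
    using that by (induction n) (simp_all add: D_partial_commute[of _ j k] D_partial_funpow_in)
  show ?thesis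
    using assms by (induction m) (simp_all add: * D_partial_funpow_in)
qed

lemma foldr_D_partial_in:
  "f \<in> PT_fin_poly \<Longrightarrow> foldr (\<lambda>j. D_partial j ^^ e j) xs f \<in> PT_fin_poly"
  by (induction xs) (simp_all add: D_partial_funpow_in)

lemma foldr_D_partial_commute:
  "f \<in> PT_fin_poly \<Longrightarrow> (D_partial k ^^ n) (foldr (\<lambda>j. D_partial j ^^ e j) xs f)
     = foldr (\<lambda>j. D_partial j ^^ e j) xs ((D_partial k ^^ n) f)"
proof (induction xs)
  case (Cons i xs)
  then show ?case
    using D_partial_funpow_commute[OF foldr_D_partial_in[OF Cons.prems], of n k "e i" i e xs] by simp
qed simp

lemma foldr_D_partial_add:
  "f \<in> PT_fin_poly \<Longrightarrow> foldr (\<lambda>j. D_partial j ^^ (d j + e j)) xs f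
     = foldr (\<lambda>j. D_partial j ^^ d j) xs (foldr (\<lambda>j. D_partial j ^^ e j) xs f)"
proof (induction xs)
  case (Cons i xs)
  have "foldr (\<lambda>j. D_partial j ^^ d j) xs ((D_partial i ^^ e i) (foldr (\<lambda>j. D_partial j ^^ e j) xs f))
    = (D_partial i ^^ e i) (foldr (\<lambda>j. D_partial j ^^ d j) xs (foldr (\<lambda>j. D_partial j ^^ e j) xs f))"
    using foldr_D_partial_commute[OF foldr_D_partial_in[OF Cons.prems]] by simp
  then show ?case using Cons by (simp add: funpow_add)
qed simp

lemma var_list: "distinct (var_list :: 'n::finite list)" "set (var_list :: 'n list) = UNIV"
  using someI_ex[OF finite_distinct_list[OF finite_class.finite_UNIV[where 'a = 'n]]]
  unfolding var_list_def by (auto simp: conj_commute)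

lemma D_monom_in: "f \<in> PT_fin_poly \<Longrightarrow> D_monom m f \<in> PT_fin_poly"
  unfolding D_monom_def by (rule foldr_D_partial_in)

lemma D_monom_0 [simp]: "D_monom 0 f = f"
proof -
  have "foldr (\<lambda>j. D_partial j ^^ Poly_Mapping.lookup 0 j) xs f = f" for xs
    by (induction xs) simp_all
  then show ?thesis by (simp add: D_monom_def)
qed

lemma D_monom_add: "f \<in> PT_fin_poly \<Longrightarrow> D_monom (u + v) f = D_monom u (D_monom v f)"
  unfolding D_monom_def by (simp add: lookup_add foldr_D_partial_add)

lemma D_monom_var: "D_monom (Poly_Mapping.single j 1) f = D_partial j f"
proof -
  have "distinct xs \<Longrightarrow> foldr (\<lambda>i. D_partial i ^^ Poly_Mapping.lookup (Poly_Mapping.single j 1) i) xs f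
     = (if j \<in> set xs then D_partial j f else f)" for xs
    by (induction xs) (auto simp: lookup_single when_def)
  from this[OF var_list(1)] show ?thesis by (simp add: D_monom_def var_list)
qed

lemma D_partial_funpow_linear:
  assumes "f \<in> PT_fin_poly" "g \<in> PT_fin_poly"
  shows "(D_partial j ^^ n) (\<lambda>x. c * f x + g x) = (\<lambda>x. c * (D_partial j ^^ n) f x + (D_partial j ^^ n) g x)"
  using assms
  by (induction n) (simp_all add: D_partial_plus D_partial_scale scale_in_PT_fin_poly D_partial_funpow_in)

lemma D_monom_linear:
  assumes "f \<in> PT_fin_poly" "g \<in> PT_fin_poly"
  shows "D_monom m (\<lambda>x. c * f x + g x) = (\<lambda>x. c * D_monom m f x + D_monom m g x)"
proof -
  have "foldr (\<lambda>j. D_partial j ^^ e j) xs (\<lambda>x. c * f x + g x)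
     = (\<lambda>x. c * foldr (\<lambda>j. D_partial j ^^ e j) xs f x + foldr (\<lambda>j. D_partial j ^^ e j) xs g x)" for xs e
    using assms by (induction xs) (simp_all add: D_partial_funpow_linear foldr_D_partial_in)
  then show ?thesis by (simp add: D_monom_def)
qed

lemma D_apply_superset:
  assumes "finite K" "Poly_Mapping.keys p \<subseteq> K"
  shows "D_apply p f x = (\<Sum>m\<in>K. Poly_Mapping.lookup p m * D_monom m f x)"
  unfolding D_apply_def using assms
  by (intro sum.mono_neutral_left) (auto simp: in_keys_iff)

lemma D_apply_add: "D_apply (p + q) f = (\<lambda>x. D_apply p f x + D_apply q f x)"
proof
  fix x
  let ?K = "Poly_Mapping.keys p \<union> Poly_Mapping.keys q"
  have "Poly_Mapping.keys (p + q) \<subseteq> ?K" by (rule keys_add)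
  then show "D_apply (p + q) f x = D_apply p f x + D_apply q f x"
    by (simp add: D_apply_superset[of ?K] lookup_add ring_distribs sum.distrib)
qed

lemma D_apply_0 [simp]: "D_apply 0 f = (\<lambda>x. 0)"
  by (simp add: D_apply_def)

lemma D_apply_single: "D_apply (Poly_Mapping.single m c) f = (\<lambda>x. c * D_monom m f x)"
  by (cases "c = 0") (simp_all add: D_apply_def)

lemma D_apply_const [simp]: "D_apply (D_const c) f = (\<lambda>x. c * f x)"
  by (simp add: D_const_def D_apply_single)

lemma D_apply_1 [simp]: "D_apply 1 f = f"
  using D_apply_const[of 1 f] by simp

lemma D_apply_var [simp]: "D_apply (D_var j) f = D_partial j f"
  by (simp add: D_var_def D_apply_single D_monom_var[simplified])

lemma D_apply_diff: "D_apply (p - q) f = (\<lambda>x. D_apply p f x - D_apply q f x)"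
  using D_apply_add[of "p - q" q f] by (simp add: fun_eq_iff)

lemma D_apply_in: "f \<in> PT_fin_poly \<Longrightarrow> D_apply p f \<in> PT_fin_poly"
  unfolding D_apply_def by (intro sum_in_PT_fin_poly scale_in_PT_fin_poly D_monom_in)

lemma D_apply_linear:
  assumes "f \<in> PT_fin_poly" "g \<in> PT_fin_poly"
  shows "D_apply p (\<lambda>x. c * f x + g x) = (\<lambda>x. c * D_apply p f x + D_apply p g x)"
  by (simp add: D_apply_def D_monom_linear[OF assms] ring_distribs sum.distrib sum_distrib_left mult_ac)

lemma D_apply_plus:
  "f \<in> PT_fin_poly \<Longrightarrow> g \<in> PT_fin_poly \<Longrightarrow> D_apply p (\<lambda>x. f x + g x) = (\<lambda>x. D_apply p f x + D_apply p g x)"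
  using D_apply_linear[of f g p 1] by simp

lemma D_apply_zero_fun [simp]: "D_apply p (\<lambda>x. 0) = (\<lambda>x. 0)"
  using D_apply_linear[OF const_in_PT_fin_poly const_in_PT_fin_poly, of p 1 0 0] by (simp add: fun_eq_iff)

lemma D_apply_scale:
  "f \<in> PT_fin_poly \<Longrightarrow> D_apply p (\<lambda>x. c * f x) = (\<lambda>x. c * D_apply p f x)"
  using D_apply_linear[OF _ const_in_PT_fin_poly, of f p c 0] by simp

lemma D_apply_sum:
  "(\<And>i. i \<in> I \<Longrightarrow> f i \<in> PT_fin_poly) \<Longrightarrow> D_apply p (\<lambda>x. \<Sum>i\<in>I. f i x) = (\<lambda>x. \<Sum>i\<in>I. D_apply p (f i) x)"
proof (induction I rule: infinite_finite_induct)
  case (insert i I)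
  then show ?case by (simp add: D_apply_plus sum_in_PT_fin_poly)
qed simp_all

text \<open>With this, signals form a module over the operators. On monomials it is the addition of
  exponents, which rests on the commutation of partial derivatives.\<close>

lemma D_apply_mult:
  assumes f: "f \<in> PT_fin_poly"
  shows "D_apply (p * q) f = D_apply p (D_apply q f)"
proof (induction p rule: poly_mapping_single_induct)
  case (single m c)
  show ?case
  proof (induction q rule: poly_mapping_single_induct)
    case (single m' c')
    have "D_apply (Poly_Mapping.single m c) (\<lambda>x. c' * D_monom m' f x) = (\<lambda>x. c' * (c * D_monom m (D_monom m' f) x))"
      by (simp only: D_apply_scale[OF D_monom_in[OF f]] D_apply_single)
    then show ?case
      unfolding mult_single D_apply_single D_monom_add[OF f] by (simp add: mult_ac)
  next
    case (plus p q)
    then show ?case by (simp add: ring_distribs D_apply_add D_apply_plus D_apply_in[OF f])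
  qed simp
qed (simp_all add: ring_distribs D_apply_add)

text \<open>Conjugation by an exponential translates the variables; for one variable this is the
  product rule. The signal \<open>f\<close> stays arbitrary in the induction because in a product
  the second operator acts first and changes it.\<close>

lemma D_apply_expo_times:
  assumes a: "a \<in> rat_points" and f: "f \<in> PT_fin_poly" and b: "\<And>j. b $ j = complex_of_real (a $ j)"
  shows "D_apply p (\<lambda>x. expo a x * f x) = (\<lambda>x. expo a x * D_apply (shift b p) f x)"
  using f
proof (induction p arbitrary: f rule: diffop_induct)
  case (const c)
  then show ?case by (simp add: mult_ac)
next
  case (var j)
  have "expo a \<in> PT_fin_poly" using expo_in_PT_fin_poly[OF a, of 1] by simp
  then show ?case
    using var by (simp add: D_partial_times D_partial_expo D_apply_add b algebra_simps)
next
  case (plus p q)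
  then show ?case by (simp add: D_apply_add shift_add ring_distribs)
next
  case (mult p q)
  have e: "expo a \<in> PT_fin_poly" using expo_in_PT_fin_poly[OF a, of 1] by simp
  show ?case
    using mult by (simp add: D_apply_mult shift_mult PT_fin_poly.times[OF e] D_apply_in)
qed

section \<open>Rational points\<close>

lemma complex_of_real_Rats: "complex_of_real r \<in> \<rat>" if "r \<in> \<rat>"
proof -
  obtain i j where "r = of_int i / of_int j"
    using \<open>r \<in> \<rat>\<close> by (rule Rats_cases')
  then show ?thesis by simp
qed

lemma complex_rat_points: "a \<in> rat_points \<Longrightarrow> (\<chi> j. complex_of_real (a $ j)) \<in> rat_points"
  by (simp add: rat_points_def complex_of_real_Rats)

text \<open>Links the two kinds of rational points: complex zeros of ideals and real frequencies of
  signals.\<close>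

lemma complex_rat_pointsE:
  fixes b :: "complex ^ 'n"
  assumes "b \<in> rat_points"
  obtains a where "a \<in> rat_points" "\<And>j. b $ j = complex_of_real (a $ j)"
proof -
  have "\<exists>r. r \<in> \<rat> \<and> b $ j = complex_of_real r" for j
  proof -
    have "b $ j \<in> \<rat>" using assms by (simp add: rat_points_def)
    then obtain i k where "b $ j = of_int i / of_int k" by (rule Rats_cases')
    then show ?thesis by (intro exI[of _ "of_int i / of_int k"]) simp
  qed
  then obtain r where "\<And>j. r j \<in> \<rat>" "\<And>j. b $ j = complex_of_real (r j)" by metis
  then show thesis using that[of "\<chi> j. r j"] by (simp add: rat_points_def)
qed

section \<open>Polynomial-exponential normal form\<close>

text \<open>\<open>expo_poly a n f\<close>: \<open>f\<close> is \<open>expo a\<close> times a polynomial of degree less than \<open>n\<close>.\<close>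

inductive expo_poly :: "real ^ 'n::finite \<Rightarrow> nat \<Rightarrow> (real ^ 'n \<Rightarrow> complex) \<Rightarrow> bool" for a where
  zero: "expo_poly a n (\<lambda>x. 0)"
| expo: "expo_poly a (Suc n) (\<lambda>x. c * expo a x)"
| coord: "expo_poly a n f \<Longrightarrow> expo_poly a (Suc n) (\<lambda>x. complex_of_real (x $ j) * f x)"
| plus: "expo_poly a n f \<Longrightarrow> expo_poly a n g \<Longrightarrow> expo_poly a n (\<lambda>x. f x + g x)"

lemma expo_poly_in: "expo_poly a n f \<Longrightarrow> a \<in> rat_points \<Longrightarrow> f \<in> PT_fin_poly"
  by (induction rule: expo_poly.induct)
    (auto intro: PT_fin_poly.intros const_in_PT_fin_poly expo_in_PT_fin_poly)

lemma expo_poly_0D: "expo_poly a n f \<Longrightarrow> n = 0 \<Longrightarrow> f = (\<lambda>x. 0)"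
  by (induction rule: expo_poly.induct) auto

lemma expo_poly_mono: "expo_poly a n f \<Longrightarrow> n \<le> m \<Longrightarrow> expo_poly a m f"
proof (induction arbitrary: m rule: expo_poly.induct)
  case (expo n c)
  then show ?case by (cases m) (auto intro: expo_poly.intros)
next
  case (coord n f j)
  then show ?case by (cases m) (auto intro: expo_poly.intros)
qed (auto intro: expo_poly.intros)

lemma expo_poly_times_expo: "expo_poly a n f \<Longrightarrow> expo_poly (a + b) n (\<lambda>x. c * expo b x * f x)"
proof (induction rule: expo_poly.induct)
  case (expo n d)
  then show ?case
    using expo_poly.expo[of "a + b" n "c * d"] by (simp add: expo_add mult_ac)
next
  case (coord n f j)
  then show ?case using expo_poly.coord[OF coord.IH, of j] by (simp add: mult_ac)
next
  case (plus n f g)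
  then show ?case using expo_poly.plus[OF plus.IH] by (simp add: ring_distribs)
qed (simp add: expo_poly.zero)

lemma expo_poly_scale: "expo_poly a n f \<Longrightarrow> expo_poly a n (\<lambda>x. c * f x)"
  using expo_poly_times_expo[of a n f 0 c] by (simp add: expo_def)

lemma expo_poly_times:
  "expo_poly a n f \<Longrightarrow> expo_poly b m g \<Longrightarrow> expo_poly (a + b) (n + m) (\<lambda>x. f x * g x)"
proof (induction rule: expo_poly.induct)
  case (expo n c)
  then show ?case
    using expo_poly_mono[OF expo_poly_times_expo[OF expo, of a c], of "Suc n + m"] by (simp add: add.commute)
next
  case (coord n f j)
  then show ?case using expo_poly.coord[OF coord.IH, of j] by (simp add: mult_ac)
next
  case (plus n f g)
  then show ?case using expo_poly.plus[OF plus.IH] by (simp add: ring_distribs)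
qed (simp add: expo_poly.zero)

text \<open>The operator D_j - a_j differentiates only the polynomial factor, hence lowers its
  degree. This is the local nilpotency behind the induction on \<open>n\<close>.\<close>

lemma expo_poly_D_partial:
  assumes a: "a \<in> rat_points"
  shows "expo_poly a n f \<Longrightarrow> expo_poly a (n - 1) (\<lambda>x. D_partial j f x - complex_of_real (a $ j) * f x)"
proof (induction rule: expo_poly.induct)
  case (zero n)
  then show ?case by (simp add: expo_poly.zero)
next
  case (expo n c)
  have "expo a \<in> PT_fin_poly" using expo_in_PT_fin_poly[OF a, of 1] by simp
  then show ?case by (simp add: D_partial_scale D_partial_expo expo_poly.zero)
next
  case (coord n f k)
  let ?g = "\<lambda>x. D_partial j f x - complex_of_real (a $ j) * f x"
  have f: "f \<in> PT_fin_poly" using coord.hyps a by (rule expo_poly_in)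
  have eq: "(\<lambda>x. D_partial j (\<lambda>x. complex_of_real (x $ k) * f x) x - complex_of_real (a $ j) * (complex_of_real (x $ k) * f x))
    = (\<lambda>x. (if j = k then - \<i> else 0) * f x + complex_of_real (x $ k) * ?g x)"
    unfolding D_partial_times[OF PT_fin_poly.coord f] D_partial_coord by (simp add: algebra_simps)
  have "expo_poly a n (\<lambda>x. (if j = k then - \<i> else 0) * f x)"
    using coord.hyps by (rule expo_poly_scale)
  \<comment> \<open>The case \<open>n = 0\<close> is separate because of truncated subtraction:
    there the rule \<open>coord\<close> would only give the bound 1, but \<open>f\<close> itself is
    zero.\<close>
  moreover have "expo_poly a n (\<lambda>x. complex_of_real (x $ k) * ?g x)"
  proof (cases n)
    case 0
    then have "f = (\<lambda>x. 0)" using expo_poly_0D coord.hyps by blast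
    then show ?thesis by (simp add: expo_poly.zero)
  next
    case (Suc m)
    then show ?thesis using expo_poly.coord[OF coord.IH] by simp
  qed
  ultimately show ?case unfolding eq diff_Suc_1 by (rule expo_poly.plus)
next
  case (plus n f g)
  have "f \<in> PT_fin_poly" "g \<in> PT_fin_poly" using plus.hyps a expo_poly_in by blast+
  then show ?case using expo_poly.plus[OF plus.IH] by (simp add: D_partial_plus algebra_simps)
qed

text \<open>Frequencies may repeat among the summands, which makes closure under sums and products
  immediate; later arguments treat the summands one at a time.\<close>

inductive expo_poly_sum :: "(real ^ 'n::finite \<Rightarrow> complex) \<Rightarrow> bool" where
  zero: "expo_poly_sum (\<lambda>x. 0)"
| add: "a \<in> rat_points \<Longrightarrow> expo_poly a n f \<Longrightarrow> expo_poly_sum g \<Longrightarrow> expo_poly_sum (\<lambda>x. f x + g x)"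

lemma expo_poly_sum_plus: "expo_poly_sum f \<Longrightarrow> expo_poly_sum g \<Longrightarrow> expo_poly_sum (\<lambda>x. f x + g x)"
proof (induction rule: expo_poly_sum.induct)
  case (add a n f h)
  then show ?case
    using expo_poly_sum.add[OF add.hyps(1,2) add.IH] by (simp add: add_ac)
qed simp

lemma expo_poly_sumI: "a \<in> rat_points \<Longrightarrow> expo_poly a n f \<Longrightarrow> expo_poly_sum f"
  using expo_poly_sum.add[OF _ _ expo_poly_sum.zero, of a n f] by simp

lemma rat_points_add: "a \<in> rat_points \<Longrightarrow> b \<in> rat_points \<Longrightarrow> a + b \<in> rat_points"
  by (simp add: rat_points_def)

lemma expo_poly_sum_times: "expo_poly_sum f \<Longrightarrow> expo_poly_sum g \<Longrightarrow> expo_poly_sum (\<lambda>x. f x * g x)"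
proof (induction rule: expo_poly_sum.induct)
  case (add a n f h)
  have "expo_poly_sum (\<lambda>x. f x * g x)"
    using add.prems
  proof (induction rule: expo_poly_sum.induct)
    case (add b m g' h')
    then show ?case
      using expo_poly_sum.add[OF rat_points_add[OF \<open>a \<in> rat_points\<close> add.hyps(1)]
          expo_poly_times[OF \<open>expo_poly a n f\<close> add.hyps(2)] add.IH]
      by (simp add: ring_distribs)
  qed (simp add: expo_poly_sum.zero)
  then show ?case using expo_poly_sum_plus add.IH[OF add.prems] by (simp add: ring_distribs)
qed (simp add: expo_poly_sum.zero)

lemma PT_fin_poly_normal_form: "f \<in> PT_fin_poly \<Longrightarrow> expo_poly_sum f"
proof (induction rule: PT_fin_poly.induct)
  case (base f)
  then obtain A c where A: "finite A" "A \<subseteq> rat_points" "f = (\<lambda>x. \<Sum>a\<in>A. c a * expo a x)"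
    unfolding PT_fin_iff by blast
  have "expo_poly_sum (\<lambda>x. \<Sum>a\<in>A. c a * expo a x)"
    using A(1,2)
  proof (induction A)
    case (insert a A)
    then show ?case
      using expo_poly_sum.add[OF _ expo_poly.expo[of a 0 "c a"]] by simp
  qed (simp add: expo_poly_sum.zero)
  then show ?case by (simp add: A(3))
next
  case (coord j)
  have "expo_poly_sum (\<lambda>x. complex_of_real (x $ j) * (1 * expo 0 x))"
    by (rule expo_poly_sumI[OF zero_in_rat_points expo_poly.coord[OF expo_poly.expo]])
  then show ?case by (simp add: expo_def)
qed (auto intro: expo_poly_sum_plus expo_poly_sum_times)

section \<open>Ideals without rational zeros act faithfully\<close>

text \<open>Membership in \<open>fixed_signals J\<close> survives going up from all the \<open>(D\<^sub>j - a\<^sub>j) f\<close> to \<open>f\<close>, since \<open>J\<close>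
  contains an element congruent to \<open>1\<close> modulo the maximal ideal of \<open>a\<close>; this drives the
  induction over the degree.\<close>

definition fixed_signals :: "('n::finite) diffop set \<Rightarrow> (real ^ 'n \<Rightarrow> complex) set" where
  "fixed_signals J = {f \<in> PT_fin_poly. \<exists>r\<in>J. D_apply r f = f}"

context
  fixes J :: "('n::finite) diffop set"
  assumes J: "diffop_ring.subspace J" and no_zero: "\<And>b. b \<in> rat_points \<Longrightarrow> \<not> J \<subseteq> point_ideal b"
begin

lemma fixed_signals_0: "(\<lambda>x. 0) \<in> fixed_signals J"
  using diffop_ring.subspace_0[OF J] by (auto simp: fixed_signals_def const_in_PT_fin_poly)

lemma fixed_signals_plus:
  assumes "f \<in> fixed_signals J" "g \<in> fixed_signals J"
  shows "(\<lambda>x. f x + g x) \<in> fixed_signals J"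
proof -
  obtain r s where r: "r \<in> J" "D_apply r f = f" and s: "s \<in> J" "D_apply s g = g"
    and fg: "f \<in> PT_fin_poly" "g \<in> PT_fin_poly"
    using assms by (auto simp: fixed_signals_def)
  \<comment> \<open>The witness comes from \<open>1 - (r + s - s * r) = (1 - s) * (1 - r)\<close>, a
    product that kills both \<open>f\<close> and \<open>g\<close>.\<close>
  have "r + s - s * r \<in> J"
    using J r s by (intro diffop_ring.subspace_diff diffop_ring.subspace_add diffop_ring.subspace_scale)
  moreover have "D_apply (r + s - s * r) (\<lambda>x. f x + g x) = (\<lambda>x. f x + g x)"
  proof -
    have "D_apply (s * r) f = D_apply s f" using D_apply_mult[OF fg(1), of s r] r by simp
    moreover have "D_apply (s * r) g = D_apply r g" using D_apply_mult[OF fg(2), of r s] s by (simp add: mult.commute)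
    ultimately show ?thesis using r s by (simp add: D_apply_plus[OF fg] D_apply_add D_apply_diff)
  qed
  ultimately show ?thesis using fg by (auto simp: fixed_signals_def PT_fin_poly.plus)
qed

lemma fixed_signals_D_apply:
  assumes "f \<in> fixed_signals J"
  shows "D_apply p f \<in> fixed_signals J"
proof -
  obtain r where r: "r \<in> J" "D_apply r f = f" and f: "f \<in> PT_fin_poly"
    using assms by (auto simp: fixed_signals_def)
  have "D_apply r (D_apply p f) = D_apply p f"
    using D_apply_mult[OF f, of r p] D_apply_mult[OF f, of p r] r(2) by (simp add: mult.commute)
  then show ?thesis using r f by (auto simp: fixed_signals_def D_apply_in)
qed

lemma fixed_signals_step:
  assumes b: "b \<in> rat_points" and f: "f \<in> PT_fin_poly"
    and step: "\<And>j. D_apply (D_var j - D_const (b $ j)) f \<in> fixed_signals J"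
  shows "f \<in> fixed_signals J"
proof -
  obtain r where r: "r \<in> J" "poly_at b r \<noteq> 0"
    using no_zero[OF b] by (auto simp: point_ideal_eq)
  \<comment> \<open>Normalised to have value 1 at \<open>b\<close>, so that \<open>1 - s\<close>
    lies in the ideal of \<open>b\<close>.\<close>
  define s where "s = D_const (1 / poly_at b r) * r"
  have s: "s \<in> J" unfolding s_def using J r(1) by (rule diffop_ring.subspace_scale)
  have "poly_at b (1 - s) = 0" using r(2) by (simp add: s_def poly_at_diff poly_at_mult)
  then have 1: "1 - s \<in> point_ideal b" by (simp add: point_ideal_eq)
  \<comment> \<open>The operators sending \<open>f\<close> to a fixed signal form an ideal, so the
    hypothesis on the generators D_j - b_j extends to \<open>1 - s\<close>.\<close>
  have "diffop_ring.subspace {p. D_apply p f \<in> fixed_signals J}"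
    using fixed_signals_0 fixed_signals_plus fixed_signals_D_apply
    by (auto simp: diffop_ring.subspace_def D_apply_add D_apply_mult[OF f])
  then have "point_ideal b \<subseteq> {p. D_apply p f \<in> fixed_signals J}"
    unfolding point_ideal_def using step by (intro diffop_ring.span_minimal) auto
  with 1 obtain t where t: "t \<in> J" "D_apply t (D_apply (1 - s) f) = D_apply (1 - s) f"
    by (auto simp: fixed_signals_def)
  then have "D_apply (t * (1 - s)) f = D_apply (1 - s) f" by (simp add: D_apply_mult[OF f])
  \<comment> \<open>If \<open>t\<close> fixes the part \<open>(1 - s) f\<close>, then
    \<open>s + t * (1 - s)\<close> sends \<open>f\<close> to
    \<open>s f + (1 - s) f = f\<close>.\<close>
  moreover have "s + t * (1 - s) = 1 + (t * (1 - s) - (1 - s))" by simp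
  ultimately have "D_apply (s + t * (1 - s)) f = f"
    by (simp only: D_apply_add D_apply_diff) simp
  moreover have "s + (1 - s) * t \<in> J"
    using J s t(1) by (intro diffop_ring.subspace_add diffop_ring.subspace_scale)
  ultimately show ?thesis using f by (auto simp: fixed_signals_def mult.commute)
qed

lemma expo_poly_fixed:
  assumes a: "a \<in> rat_points"
  shows "expo_poly a n f \<Longrightarrow> f \<in> fixed_signals J"
proof (induction n arbitrary: f)
  case 0
  then show ?case using expo_poly_0D fixed_signals_0 by blast
next
  case (Suc n)
  define b :: "complex ^ 'n" where "b = (\<chi> j. complex_of_real (a $ j))"
  have "b \<in> rat_points" unfolding b_def using a by (rule complex_rat_points)
  moreover have "f \<in> PT_fin_poly" using Suc.prems a by (rule expo_poly_in)
  moreover have "D_apply (D_var j - D_const (b $ j)) f \<in> fixed_signals J" for j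
    using Suc.IH[of "\<lambda>x. D_partial j f x - complex_of_real (a $ j) * f x"] expo_poly_D_partial[OF a Suc.prems, of j]
    by (simp add: D_apply_diff b_def)
  ultimately show ?case by (rule fixed_signals_step)
qed

lemma all_signals_fixed:
  assumes "f \<in> PT_fin_poly"
  shows "f \<in> fixed_signals J"
  using PT_fin_poly_normal_form[OF assms]
  by (induction rule: expo_poly_sum.induct) (auto intro: fixed_signals_0 fixed_signals_plus expo_poly_fixed)

lemma faithful_action:
  assumes f: "f \<in> PT_fin_poly" and kill: "\<And>r. r \<in> J \<Longrightarrow> D_apply r f = (\<lambda>x. 0)"
  shows "f = (\<lambda>x. 0)"
  using all_signals_fixed[OF f] kill by (auto simp: fixed_signals_def)

end

section \<open>Polynomial solutions from linear functionals\<close>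

text \<open>Normalised so that the operator D_j lowers the exponent of x_j by one without a factor.
  These polynomials are dual to the operator monomials under applying an operator and evaluating at
  the origin.\<close>

definition divided_monom :: "('n::finite \<Rightarrow>\<^sub>0 nat) \<Rightarrow> real ^ 'n \<Rightarrow> complex" where
  "divided_monom m x = (\<Prod>j\<in>UNIV. (\<i> * complex_of_real (x $ j)) ^ Poly_Mapping.lookup m j / fact (Poly_Mapping.lookup m j))"

lemma prod_in_PT_fin_poly:
  "(\<And>i. i \<in> I \<Longrightarrow> f i \<in> PT_fin_poly) \<Longrightarrow> (\<lambda>x. \<Prod>i\<in>I. f i x) \<in> PT_fin_poly"
proof (induction I rule: infinite_finite_induct)
  case (insert i I)
  then show ?case by (simp add: PT_fin_poly.times)
qed (simp_all add: const_in_PT_fin_poly)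

lemma divided_monom_in: "divided_monom m \<in> PT_fin_poly"
proof -
  have "(\<lambda>x. (\<i> * complex_of_real (x $ j)) ^ k) \<in> PT_fin_poly" for j :: 'a and k
    by (induction k) (simp_all add: const_in_PT_fin_poly PT_fin_poly.times PT_fin_poly.coord)
  from scale_in_PT_fin_poly[OF this, of "1 / fact k" for k]
  have "(\<lambda>x. (\<i> * complex_of_real (x $ j)) ^ k / fact k) \<in> PT_fin_poly" for j :: 'a and k
    by simp
  then have "(\<lambda>x. \<Prod>j\<in>UNIV. (\<i> * complex_of_real (x $ j)) ^ Poly_Mapping.lookup m j / fact (Poly_Mapping.lookup m j)) \<in> PT_fin_poly"
    by (intro prod_in_PT_fin_poly)
  then show ?thesis by (simp add: divided_monom_def[abs_def])
qed

lemma divided_monom_at_0: "divided_monom m 0 = (if m = 0 then 1 else 0)"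
proof (cases "m = 0")
  case False
  then obtain j where "Poly_Mapping.lookup m j \<noteq> 0" by (auto simp: poly_mapping_eq_iff fun_eq_iff)
  then show ?thesis using False by (auto simp: divided_monom_def)
qed (simp add: divided_monom_def)

lemma D_partial_divided_monom_Suc:
  "D_partial j (divided_monom (m + Poly_Mapping.single j 1)) = divided_monom m"
proof (rule ext, rule D_partial_eqI)
  fix x
  define n where "n = Poly_Mapping.lookup m j"
  define R where "R = (\<Prod>i\<in>UNIV - {j}. (\<i> * complex_of_real (x $ i)) ^ Poly_Mapping.lookup m i / fact (Poly_Mapping.lookup m i))"
  have 1: "divided_monom (m + Poly_Mapping.single j 1) (x + t *\<^sub>R axis j 1)
     = ((\<i> * complex_of_real (x $ j + t)) ^ Suc n / fact (Suc n)) * R" for t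
    unfolding divided_monom_def
    by (subst prod.remove[of _ j]) (auto simp: R_def n_def lookup_add lookup_single axis_def intro!: prod.cong)
  have 2: "divided_monom m x = (\<i> * complex_of_real (x $ j)) ^ n / fact n * R"
    unfolding divided_monom_def by (subst prod.remove[of _ j]) (auto simp: R_def n_def)
  have "((\<lambda>z. (\<i> * (complex_of_real (x $ j) + z)) ^ Suc n) has_field_derivative
      of_nat (Suc n) * ((\<i> * complex_of_real (x $ j)) ^ n * \<i>)) (at (of_real 0))"
    by (auto intro!: derivative_eq_intros simp del: of_nat_Suc power_Suc)
  from has_vector_derivative_real_field[OF DERIV_cmult[OF this, of "R / fact (Suc n)"]]
  have "((\<lambda>t. R / fact (Suc n) * (\<i> * (complex_of_real (x $ j) + of_real t)) ^ Suc n) has_vector_derivative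
      R / fact (Suc n) * (of_nat (Suc n) * ((\<i> * complex_of_real (x $ j)) ^ n * \<i>))) (at 0)" .
  moreover have "R / fact (Suc n) * (of_nat (Suc n) * ((\<i> * complex_of_real (x $ j)) ^ n * \<i>)) = \<i> * divided_monom m x"
    unfolding 2 by (simp del: of_nat_Suc)
  ultimately show "((\<lambda>t. divided_monom (m + Poly_Mapping.single j 1) (x + t *\<^sub>R axis j 1)) has_vector_derivative \<i> * divided_monom m x) (at 0)"
    unfolding 1 by (simp add: mult_ac)
qed

lemma D_partial_divided_monom_0:
  assumes "Poly_Mapping.lookup m j = 0"
  shows "D_partial j (divided_monom m) = (\<lambda>x. 0)"
proof (rule ext, rule D_partial_eqI)
  fix x
  have "divided_monom m (x + t *\<^sub>R axis j 1) = divided_monom m x" for t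
    unfolding divided_monom_def using assms by (intro prod.cong) (auto simp: axis_def)
  then show "((\<lambda>t. divided_monom m (x + t *\<^sub>R axis j 1)) has_vector_derivative \<i> * 0) (at 0)" by simp
qed

lemma finite_monom_degree_less: "finite {m :: 'n::finite \<Rightarrow>\<^sub>0 nat. monom_degree m < k}"
proof (rule finite_imageD)
  have "Poly_Mapping.lookup m i \<le> monom_degree m" for m and i :: 'n
    unfolding monom_degree_def by (rule member_le_sum) auto
  then have "Poly_Mapping.lookup ` {m :: 'n \<Rightarrow>\<^sub>0 nat. monom_degree m < k} \<subseteq> PiE UNIV (\<lambda>_. {..<k})"
    by (fastforce intro: le_less_trans)
  then show "finite (Poly_Mapping.lookup ` {m :: 'n \<Rightarrow>\<^sub>0 nat. monom_degree m < k})"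
    by (rule finite_subset) (intro finite_PiE, simp_all)
  show "inj_on Poly_Mapping.lookup {m :: 'n \<Rightarrow>\<^sub>0 nat. monom_degree m < k}"
    by (auto intro!: inj_onI poly_mapping_eqI)
qed

text \<open>\<open>jet_poly k l\<close> is the polynomial whose Taylor coefficients at \<open>0\<close> are prescribed by \<open>l\<close>.\<close>

definition jet_functional :: "nat \<Rightarrow> (('n::finite) diffop \<Rightarrow> complex) \<Rightarrow> bool" where
  "jet_functional k l \<longleftrightarrow> (\<forall>p q. l (p + q) = l p + l q) \<and> (\<forall>c p. l (D_const c * p) = c * l p) \<and>
     (\<forall>p. (\<forall>m\<in>Poly_Mapping.keys p. k \<le> monom_degree m) \<longrightarrow> l p = 0)"

definition jet_poly :: "nat \<Rightarrow> (('n::finite) diffop \<Rightarrow> complex) \<Rightarrow> real ^ 'n \<Rightarrow> complex" where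
  "jet_poly k l x = (\<Sum>m | monom_degree m < k. l (Poly_Mapping.single m 1) * divided_monom m x)"

lemma jet_poly_in: "jet_poly k l \<in> PT_fin_poly"
  unfolding jet_poly_def[abs_def] by (intro sum_in_PT_fin_poly scale_in_PT_fin_poly divided_monom_in)

text \<open>Powers of the maximal ideal are ideals, so composing with a multiplication preserves
  vanishing on them.\<close>

lemma jet_functional_mult:
  assumes "jet_functional k l"
  shows "jet_functional k (\<lambda>p. l (q * p))"
proof -
  have "k \<le> monom_degree m" if "\<forall>m\<in>Poly_Mapping.keys p. k \<le> monom_degree m" "m \<in> Poly_Mapping.keys (q * p)" for p m
    using that keys_mult[of q p] by (fastforce simp: monom_degree_add)
  moreover have "l (q * (D_const c * p)) = c * l (q * p)" for c p
    using assms unfolding jet_functional_def mult.left_commute[of q] by blast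
  ultimately show ?thesis
    using assms unfolding jet_functional_def by (simp add: distrib_left)
qed

lemma D_partial_jet_poly:
  fixes j :: "'n::finite"
  assumes l: "jet_functional k l"
  shows "D_partial j (jet_poly k l) = jet_poly k (\<lambda>p. l (D_var j * p))"
proof
  fix x
  let ?K = "{m. monom_degree m < k}"
  define e :: "'n \<Rightarrow>\<^sub>0 nat" where "e = Poly_Mapping.single j 1"
  have deg: "monom_degree e = 1"
    by (simp add: e_def monom_degree_def lookup_single when_def)
  have "D_partial j (\<lambda>x. l (Poly_Mapping.single m 1) * divided_monom m x) = (\<lambda>x. l (Poly_Mapping.single m 1) * D_partial j (divided_monom m) x)" for m
    by (rule D_partial_scale[OF divided_monom_in])
  then have "D_partial j (jet_poly k l) x = (\<Sum>m\<in>?K. l (Poly_Mapping.single m 1) * D_partial j (divided_monom m) x)"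
    using D_apply_sum[of ?K "\<lambda>m x. l (Poly_Mapping.single m 1) * divided_monom m x" "D_var j"]
    by (simp add: jet_poly_def[abs_def] scale_in_PT_fin_poly divided_monom_in)
  \<comment> \<open>Only monomials containing the variable survive; for these
    \<open>m - e + e = m\<close> despite truncated subtraction.\<close>
  also have "\<dots> = (\<Sum>m\<in>{m\<in>?K. Poly_Mapping.lookup m j \<noteq> 0}. l (Poly_Mapping.single m 1) * D_partial j (divided_monom m) x)"
    by (rule sum.mono_neutral_right) (auto simp: finite_monom_degree_less D_partial_divided_monom_0)
  also have "\<dots> = (\<Sum>m\<in>{m. monom_degree m + 1 < k}. l (Poly_Mapping.single (m + e) 1) * divided_monom m x)"
  proof (rule sum.reindex_bij_witness[of _ "\<lambda>m. m + e" "\<lambda>m. m - e"])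
    fix m :: "'n \<Rightarrow>\<^sub>0 nat" assume m: "m \<in> {m\<in>?K. Poly_Mapping.lookup m j \<noteq> 0}"
    then show *: "m - e + e = m"
      by (intro poly_mapping_eqI) (auto simp: e_def lookup_add lookup_minus lookup_single when_def)
    have "monom_degree (m - e) + 1 = monom_degree m"
      using * deg monom_degree_add[of "m - e" e] by simp
    then show "m - e \<in> {m. monom_degree m + 1 < k}" using m by simp
    show "l (Poly_Mapping.single (m - e + e) 1) * divided_monom (m - e) x
        = l (Poly_Mapping.single m 1) * D_partial j (divided_monom m) x"
      using D_partial_divided_monom_Suc[of j "m - e"] * by (simp add: e_def)
  next
    fix m :: "'n \<Rightarrow>\<^sub>0 nat" assume m: "m \<in> {m. monom_degree m + 1 < k}"
    show "m + e - e = m" by simp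
    show "m + e \<in> {m\<in>?K. Poly_Mapping.lookup m j \<noteq> 0}"
      using m deg by (simp add: monom_degree_add lookup_add e_def)
  qed
  \<comment> \<open>The monomials of degree \<open>k - 1\<close> may be put back because
    \<open>l\<close> vanishes on monomials of degree \<open>k\<close>.\<close>
  also have "\<dots> = (\<Sum>m\<in>?K. l (Poly_Mapping.single (m + e) 1) * divided_monom m x)"
  proof (rule sum.mono_neutral_left[OF finite_monom_degree_less])
    have "l (Poly_Mapping.single (m + e) 1) = 0" if "\<not> monom_degree m + 1 < k" for m
      using l that deg unfolding jet_functional_def by (simp add: monom_degree_add)
    then show "\<forall>m\<in>?K - {m. monom_degree m + 1 < k}. l (Poly_Mapping.single (m + e) 1) * divided_monom m x = 0"
      by simp
  qed auto
  also have "\<dots> = jet_poly k (\<lambda>p. l (D_var j * p)) x"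
    by (simp add: jet_poly_def D_var_def e_def mult_single add.commute)
  finally show "D_partial j (jet_poly k l) x = jet_poly k (\<lambda>p. l (D_var j * p)) x" .
qed

text \<open>Differentiation is the transpose of multiplication, as in Macaulay's inverse systems:
  differential equations for the polynomial become linear conditions on \<open>l\<close>.\<close>

lemma D_apply_jet_poly:
  "jet_functional k l \<Longrightarrow> D_apply r (jet_poly k l) = jet_poly k (\<lambda>p. l (r * p))"
proof (induction r arbitrary: l rule: diffop_induct)
  case (const c)
  then show ?case
    by (simp add: jet_functional_def jet_poly_def[abs_def] sum_distrib_left mult_ac)
next
  case (var j)
  then show ?case by (simp add: D_partial_jet_poly)
next
  case (plus p q)
  then show ?case
    by (simp add: D_apply_add jet_functional_def jet_poly_def ring_distribs sum.distrib)
next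
  case (mult p q)
  have "D_apply (p * q) (jet_poly k l) = D_apply p (jet_poly k (\<lambda>s. l (q * s)))"
    using mult by (simp add: D_apply_mult jet_poly_in)
  also have "\<dots> = jet_poly k (\<lambda>s. l (q * (p * s)))"
    by (rule mult.IH(1)[OF jet_functional_mult[OF mult.prems]])
  also have "(\<lambda>s. l (q * (p * s))) = (\<lambda>s. l (p * q * s))"
    by (simp only: mult.assoc mult.left_commute[of q p])
  finally show ?case .
qed

text \<open>The degree bound is a successor so that the constant monomial occurs in the sum; all
  other summands vanish at the origin.\<close>

lemma jet_poly_at_0: "jet_poly (Suc k) l 0 = l 1"
proof -
  have "jet_poly (Suc k) l 0 = (\<Sum>m | monom_degree m < Suc k. if m = 0 then l (Poly_Mapping.single m 1) else 0)"
    unfolding jet_poly_def by (rule sum.cong) (auto simp: divided_monom_at_0)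
  also have "\<dots> = l 1" by (subst sum.delta[OF finite_monom_degree_less]) (simp add: monom_degree_def)
  finally show ?thesis .
qed

section \<open>Complex linear functionals on the free module\<close>

interpretation diffop_vs: vector_space "\<lambda>c (p :: 'n diffop ^ 'q). D_const c *s p"
  by unfold_locales (simp_all add: D_const_add D_const_mult diffop_free.scale_left_distrib diffop_free.scale_right_distrib)

interpretation diffop_functional: vector_space_pair "\<lambda>c (p :: 'n diffop ^ 'q). D_const c *s p" "(*) :: complex \<Rightarrow> complex \<Rightarrow> complex"
  by unfold_locales (simp_all add: ring_distribs)

text \<open>A basis of \<open>K\<close> stays independent after adding \<open>x\<close>, so the
  indicator of \<open>x\<close> on this set extends linearly.\<close>

lemma separating_functional:
  fixes x :: "'n diffop ^ 'q"
  assumes K: "diffop_vs.subspace K" and x: "x \<notin> K"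
  obtains l :: "'n diffop ^ 'q \<Rightarrow> complex" where "\<And>p q. l (p + q) = l p + l q" "\<And>c p. l (D_const c *s p) = c * l p"
    "\<And>p. p \<in> K \<Longrightarrow> l p = 0" "l x = 1"
proof -
  obtain B where B: "B \<subseteq> K" "diffop_vs.independent B" "K \<subseteq> diffop_vs.span B"
    using diffop_vs.maximal_independent_subset[of K] by blast
  have "x \<notin> diffop_vs.span B" using x diffop_vs.span_minimal[OF B(1) K] by blast
  then have ind: "diffop_vs.independent (insert x B)" using B(2) by (simp add: diffop_vs.independent_insert)
  obtain l where l: "Vector_Spaces.linear (\<lambda>c (p :: 'n diffop ^ 'q). D_const c *s p) (*) l"
      and lx: "\<forall>v\<in>insert x B. l v = (if v = x then 1 else 0 :: complex)"
    using diffop_functional.linear_independent_extend[OF ind, of "\<lambda>v. if v = x then 1 else 0"] by blast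
  have "l p = 0" if "p \<in> diffop_vs.span B" for p
    using that by (rule diffop_functional.linear_eq_0_on_span[OF l, rotated]) (use lx B(1) x in auto)
  then have "l p = 0" if "p \<in> K" for p using that B(3) by blast
  moreover have "l x = 1" using lx by simp
  ultimately show thesis
    by (intro that[of l] diffop_functional.linear_add[OF l] diffop_functional.linear_scale[OF l])
qed

section \<open>The Willems closure\<close>


lemma row_apply_in: "(\<And>j. f $ j \<in> PT_fin_poly) \<Longrightarrow> row_apply r f \<in> PT_fin_poly"
  unfolding row_apply_def by (intro sum_in_PT_fin_poly D_apply_in)

lemma row_apply_plus: "row_apply (r + s) f = (\<lambda>x. row_apply r f x + row_apply s f x)"
  by (simp add: row_apply_def D_apply_add sum.distrib)

lemma row_apply_0: "row_apply 0 f = (\<lambda>x. 0)"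
  by (simp add: row_apply_def)

lemma row_apply_scale:
  assumes "\<And>j. f $ j \<in> PT_fin_poly"
  shows "row_apply (p *s r) f = D_apply p (row_apply r f)"
  unfolding row_apply_def
  by (subst D_apply_sum) (simp_all add: D_apply_in D_apply_mult assms)

lemma subspace_willems_closure: "diffop_free.subspace (willems_closure M)"
  unfolding diffop_free.subspace_def willems_closure_def behavior_perp_def behavior_def
  by (auto simp: row_apply_0 row_apply_plus row_apply_scale)

lemma subset_willems_closure: "M \<subseteq> willems_closure M"
  by (auto simp: willems_closure_def behavior_perp_def behavior_def)

lemma subspace_quotient_ideal:
  assumes M: "diffop_free.subspace M"
  shows "diffop_ring.subspace {r. r *s x \<in> M}"
proof -
  have "0 *s x \<in> M" using diffop_free.subspace_0[OF M] by simp
  moreover have "(r + s) *s x \<in> M" if "r *s x \<in> M" "s *s x \<in> M" for r s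
    using diffop_free.subspace_add[OF M that] by (simp only: diffop_free.scale_left_distrib)
  moreover have "(s * r) *s x \<in> M" if "r *s x \<in> M" for r s
    using diffop_free.subspace_scale[OF M that, of s] by (simp only: diffop_free.scale_scale)
  ultimately show ?thesis unfolding diffop_ring.subspace_def by blast
qed

lemma in_willems_closureI:
  assumes M: "diffop_free.subspace M"
    and x: "\<And>b. b \<in> rat_points \<Longrightarrow> \<not> {r. r *s x \<in> M} \<subseteq> point_ideal b"
  shows "x \<in> willems_closure M"
proof -
  have "row_apply x f = (\<lambda>y. 0)" if f: "f \<in> behavior M" for f
  proof (rule faithful_action[OF subspace_quotient_ideal[OF M] x])
    have f': "f $ j \<in> PT_fin_poly" for j using f by (simp add: behavior_def)
    then show "row_apply x f \<in> PT_fin_poly" by (rule row_apply_in)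
    fix r assume "r \<in> {r. r *s x \<in> M}"
    then have "row_apply (r *s x) f = (\<lambda>y. 0)" using f by (simp add: behavior_def)
    then show "D_apply r (row_apply x f) = (\<lambda>x. 0)" by (simp add: row_apply_scale f')
  qed
  then show ?thesis by (simp add: willems_closure_def behavior_perp_def)
qed

section \<open>Translation on the free module\<close>

definition shift_vec :: "complex ^ 'n \<Rightarrow> ('n::finite) diffop ^ 'q \<Rightarrow> 'n diffop ^ 'q" where
  "shift_vec b p = (\<chi> j. shift b (p $ j))"

lemma shift_vec_add: "shift_vec b (p + q) = shift_vec b p + shift_vec b q"
  and shift_vec_scale: "shift_vec b (r *s p) = shift b r *s shift_vec b p"
  and shift_vec_0: "shift_vec b 0 = 0"
  and shift_vec_inverse: "shift_vec (- b) (shift_vec b p) = p"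
  by (simp_all add: shift_vec_def vec_eq_iff shift_add shift_mult shift_shift)

lemma shift_shift_uminus: "shift b (shift (- b) r) = r"
  by (simp add: shift_shift)

text \<open>\<open>shift_vec b\<close> is only semilinear, so a scalar \<open>r\<close> acting on
  the image has to be pulled back to \<open>shift (- b) r\<close>.\<close>

lemma subspace_shift_vec_image:
  assumes M: "diffop_free.subspace M"
  shows "diffop_free.subspace (shift_vec b ` M)"
  unfolding diffop_free.subspace_def
proof (intro conjI ballI allI)
  show "0 \<in> shift_vec b ` M"
    using diffop_free.subspace_0[OF M] shift_vec_0 by (metis image_eqI)
next
  fix p q assume "p \<in> shift_vec b ` M" "q \<in> shift_vec b ` M"
  then show "p + q \<in> shift_vec b ` M"
    using diffop_free.subspace_add[OF M] by (auto simp flip: shift_vec_add)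
next
  fix r p assume "p \<in> shift_vec b ` M"
  then obtain p' where p': "p' \<in> M" "p = shift_vec b p'" by blast
  then have "r *s p = shift_vec b (shift (- b) r *s p')"
    by (simp only: shift_vec_scale shift_shift_uminus)
  then show "r *s p \<in> shift_vec b ` M"
    using diffop_free.subspace_scale[OF M p'(1)] by blast
qed

lemma axis_linear:
  "axis j (p + q) = axis j p + (axis j q :: 'n diffop ^ 'q)"
  "axis j (r * p) = r *s (axis j p :: 'n diffop ^ 'q)"
  by (simp_all add: axis_def vec_eq_iff)

lemma sum_axis: "(\<Sum>j\<in>UNIV. axis j (r $ j)) = (r :: 'n diffop ^ 'q::finite)"
proof -
  have "(\<Sum>j\<in>UNIV. axis j (r $ j) $ i) = (\<Sum>j\<in>UNIV. if j = i then r $ i else 0)" for i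
    by (rule sum.cong) (auto simp: axis_def)
  then show ?thesis by (simp add: vec_eq_iff)
qed

text \<open>Contrapositive of the remaining inclusion: after translating \<open>b\<close> to \<open>0\<close>, Krull's theorem places \<open>x\<close>
  outside \<open>M\<close> plus a power of the maximal ideal, and a linear functional separating the two is the
  jet at \<open>0\<close> of a signal in the behavior of \<open>M\<close>.\<close>

lemma willems_closureD:
  fixes M :: "(('n::finite) diffop ^ 'q::finite) set"
  assumes M: "diffop_free.subspace M" and x: "x \<in> willems_closure M" and b: "b \<in> rat_points"
  shows "\<not> {r. r *s x \<in> M} \<subseteq> point_ideal b"
proof
  assume ideal: "{r. r *s x \<in> M} \<subseteq> point_ideal b"
  obtain a where a: "a \<in> rat_points" "\<And>j. b $ j = complex_of_real (a $ j)"
    by (rule complex_rat_pointsE[OF b]) (rule that)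
  define M' where "M' = shift_vec b ` M"
  define x' where "x' = shift_vec b x"
  have M': "diffop_free.subspace M'" unfolding M'_def using M by (rule subspace_shift_vec_image)
  \<comment> \<open>Otherwise Krull's theorem gives \<open>r\<close> with constant coefficient 1 and
    \<open>r *s x'\<close> in \<open>M'\<close>; translated back, it multiplies \<open>x\<close>
    into \<open>M\<close> and has value 1 at \<open>b\<close>.\<close>
  obtain k where k: "\<And>m. m \<in> M' \<Longrightarrow> \<not> order_ge k (x' - m)"
  proof (rule ccontr)
    assume "\<not> thesis"
    then have "\<exists>m\<in>M'. order_ge k (x' - m)" for k using that by blast
    then obtain r where r: "Poly_Mapping.lookup r 0 = 1" "r *s x' \<in> M'"
      using krull_intersection[OF M'] by blast
    then obtain m where m: "m \<in> M" "r *s x' = shift_vec b m" unfolding M'_def by blast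
    have "shift_vec b (shift (- b) r *s x) = shift_vec b m"
      using m(2) by (simp only: shift_vec_scale shift_shift_uminus x'_def)
    then have "shift (- b) r *s x = m" by (metis shift_vec_inverse)
    then have "shift (- b) r \<in> point_ideal b" using ideal m(1) by blast
    then have "Poly_Mapping.lookup r 0 = 0" by (simp add: point_ideal_eq poly_at_def shift_shift_uminus)
    then show False using r(1) by simp
  qed
  \<comment> \<open>Order at least 0 always holds, so \<open>k\<close> is positive; this allows
    evaluating jets at the origin below.\<close>
  have "k \<noteq> 0" using k[OF diffop_free.subspace_0[OF M']] by (intro notI) simp
  then obtain k' where k': "k = Suc k'" by (cases k) auto
  \<comment> \<open>The sum of \<open>M'\<close> and all elements of order at least
    \<open>k\<close>. Vanishing on the first gives the equations of \<open>M\<close>, vanishing on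
    the second makes the components of \<open>l\<close> functionals on jets.\<close>
  define K where "K = {p. \<exists>m\<in>M'. order_ge k (p - m)}"
  have "diffop_vs.subspace K"
    unfolding diffop_vs.subspace_def
  proof (intro conjI ballI allI)
    show "0 \<in> K" unfolding K_def using diffop_free.subspace_0[OF M']
      by (auto intro!: bexI[of _ 0])
  next
    fix p q assume "p \<in> K" "q \<in> K"
    then obtain m m' where m: "m \<in> M'" "order_ge k (p - m)" "m' \<in> M'" "order_ge k (q - m')"
      unfolding K_def by blast
    \<comment> \<open>The sum is written as an iterated difference, the operation under which
      \<open>order_ge\<close> is known to be stable.\<close>
    have "order_ge k (0 - (q - m'))" by (rule order_ge_diff[OF order_ge_zero m(4)])
    with m(2) have "order_ge k ((p - m) - (0 - (q - m')))" by (rule order_ge_diff)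
    also have "(p - m) - (0 - (q - m')) = (p + q) - (m + m')" by simp
    finally show "p + q \<in> K" unfolding K_def using diffop_free.subspace_add[OF M' m(1,3)] by blast
  next
    fix c p assume "p \<in> K"
    then obtain m where m: "m \<in> M'" "order_ge k (p - m)" unfolding K_def by blast
    have "vterms (D_const c *s (p - m)) \<subseteq> vterms (p - m)"
      using vterms_single_mult[of 0 c "p - m"] by (auto simp: D_const_def)
    then have "order_ge k (D_const c *s (p - m))" using m(2) by (auto simp: order_ge_def)
    then have "order_ge k (D_const c *s p - D_const c *s m)" by (simp only: diffop_free.scale_right_diff_distrib)
    then show "D_const c *s p \<in> K" unfolding K_def using diffop_free.subspace_scale[OF M' m(1)] by blast
  qed
  moreover have "x' \<notin> K" unfolding K_def using k by blast
  ultimately obtain l :: "'n diffop ^ 'q \<Rightarrow> complex" where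
    l: "\<And>p q. l (p + q) = l p + l q" "\<And>c p. l (D_const c *s p) = c * l p" "\<And>p. p \<in> K \<Longrightarrow> l p = 0" "l x' = 1"
    by (rule separating_functional) (rule that)
  have lM: "l m = 0" if "m \<in> M'" for m
    using that by (intro l(3)) (auto simp: K_def intro!: bexI[of _ m])
  have l0: "l 0 = 0" using l(2)[of 0 0] by simp
  have lsum: "l (\<Sum>i\<in>I. p i) = (\<Sum>i\<in>I. l (p i))" for I :: "'q set" and p
    by (induction I rule: infinite_finite_induct) (simp_all add: l(1) l0)
  define lj where "lj j p = l (axis j p)" for j p
  have jet: "jet_functional k (lj j)" for j
  proof -
    have "l (axis j p) = 0" if p: "\<forall>m\<in>Poly_Mapping.keys p. k \<le> monom_degree m" for p
    proof (rule l(3))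
      have "order_ge k (axis j p)" using p by (auto simp: order_ge_def vterms_def axis_def split: if_splits)
      then show "axis j p \<in> K" unfolding K_def using diffop_free.subspace_0[OF M'] by (auto intro!: bexI[of _ 0])
    qed
    then show ?thesis unfolding jet_functional_def lj_def by (simp add: axis_linear l)
  qed
  define f :: "(real ^ 'n \<Rightarrow> complex) ^ 'q" where "f = (\<chi> j. (\<lambda>y. expo a y * jet_poly k (lj j) y))"
  have e: "expo a \<in> PT_fin_poly" using expo_in_PT_fin_poly[OF a(1), of 1] by simp
  have f: "f $ j \<in> PT_fin_poly" for j
    by (simp add: f_def PT_fin_poly.times[OF e] jet_poly_in)
  \<comment> \<open>All Taylor coefficients of \<open>row_apply r f\<close>, after removing the
    exponential, are values of \<open>l\<close> on monomial multiples of
    \<open>shift_vec b r\<close>. They vanish for \<open>r\<close> in \<open>M\<close> because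
    \<open>M'\<close> is a submodule.\<close>
  have row: "row_apply r f y = expo a y * jet_poly k (\<lambda>p. l (p *s shift_vec b r)) y" for r y
  proof -
    have "D_apply (r $ j) (f $ j) = (\<lambda>y. expo a y * jet_poly k (\<lambda>p. lj j (shift b (r $ j) * p)) y)" for j
      by (simp add: f_def D_apply_expo_times[OF a(1) jet_poly_in a(2)] D_apply_jet_poly[OF jet])
    then have "row_apply r f y = expo a y * (\<Sum>j\<in>UNIV. jet_poly k (\<lambda>p. lj j (shift b (r $ j) * p)) y)"
      by (simp add: row_apply_def sum_distrib_left)
    also have "(\<Sum>j\<in>UNIV. jet_poly k (\<lambda>p. lj j (shift b (r $ j) * p)) y)
        = (\<Sum>m | monom_degree m < k. (\<Sum>j\<in>UNIV. lj j (shift b (r $ j) * Poly_Mapping.single m 1)) * divided_monom m y)"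
      unfolding jet_poly_def by (subst sum.swap) (simp add: sum_distrib_right)
    also have "\<dots> = jet_poly k (\<lambda>p. l (p *s shift_vec b r)) y"
    proof -
      have "(\<Sum>j\<in>UNIV. lj j (shift b (r $ j) * p)) = l (p *s shift_vec b r)" for p
      proof -
        have "(\<Sum>j\<in>UNIV. lj j (shift b (r $ j) * p)) = l (\<Sum>j\<in>UNIV. axis j ((p *s shift_vec b r) $ j))"
          by (simp add: lsum lj_def shift_vec_def mult.commute)
        then show ?thesis by (simp only: sum_axis)
      qed
      then show ?thesis by (simp only: jet_poly_def)
    qed
    finally show ?thesis .
  qed
  have "row_apply r f = (\<lambda>y. 0)" if "r \<in> M" for r
  proof -
    have "shift_vec b r \<in> M'" using that by (simp add: M'_def)
    then have "l (p *s shift_vec b r) = 0" for p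
      using lM diffop_free.subspace_scale[OF M'] by blast
    then show ?thesis by (simp add: row jet_poly_def fun_eq_iff)
  qed
  then have "f \<in> behavior M" using f by (simp add: behavior_def)
  then have "row_apply x f = (\<lambda>y. 0)" using x by (simp add: willems_closure_def behavior_perp_def)
  \<comment> \<open>At the origin the exponential is 1 and only the multiplier 1 contributes,
    leaving \<open>l x' = 1\<close>.\<close>
  moreover have "row_apply x f 0 = 1"
    by (simp add: row k' jet_poly_at_0) (simp add: l(4) flip: x'_def)
  ultimately show False by simp
qed

section \<open>Supports\<close>

lemma quot_annihilator_eq:
  assumes M: "diffop_free.subspace M"
  shows "quot_annihilator N M = {r. \<forall>x\<in>N. r *s x \<in> M}"
proof -
  have "quot_scale M r ((+) x ` M) = M \<longleftrightarrow> r *s x \<in> M" for r x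
  proof
    have "r *s (x + 0) + 0 \<in> quot_scale M r ((+) x ` M)"
      using diffop_free.subspace_0[OF M] unfolding quot_scale_def by blast
    then show "r *s x \<in> M" if "quot_scale M r ((+) x ` M) = M" using that by simp
  next
    assume rx: "r *s x \<in> M"
    show "quot_scale M r ((+) x ` M) = M"
    proof
      have "r *s (x + m) + m' \<in> M" if "m \<in> M" "m' \<in> M" for m m'
        unfolding diffop_free.scale_right_distrib
        by (rule diffop_free.subspace_add[OF M diffop_free.subspace_add[OF M rx
              diffop_free.subspace_scale[OF M that(1)]] that(2)])
      then show "quot_scale M r ((+) x ` M) \<subseteq> M" by (auto simp: quot_scale_def)
      show "M \<subseteq> quot_scale M r ((+) x ` M)"
      proof
        fix m assume "m \<in> M"
        then have "m - r *s x \<in> M" using rx M by (intro diffop_free.subspace_diff)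
        moreover have "x + 0 \<in> (+) x ` M" using diffop_free.subspace_0[OF M] by blast
        moreover have "m = r *s (x + 0) + (m - r *s x)" by simp
        ultimately show "m \<in> quot_scale M r ((+) x ` M)" unfolding quot_scale_def by blast
      qed
    qed
  qed
  then show ?thesis by (auto simp: quot_annihilator_def quot_module_def)
qed

lemma point_ideal_prime: "p * q \<in> point_ideal b \<longleftrightarrow> p \<in> point_ideal b \<or> q \<in> point_ideal b"
  by (simp add: point_ideal_eq poly_at_mult)

lemma one_notin_point_ideal: "1 \<notin> point_ideal b"
  by (simp add: point_ideal_eq)

text \<open>Each of finitely many generators has a multiplier outside the ideal of \<open>b\<close>.
  Their product stays outside because the ideal is prime, and it annihilates the whole
  quotient.\<close>

lemma quot_support_disjoint:
  fixes M :: "(('n::finite) diffop ^ 'q::finite) set"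
  assumes M: "diffop_free.subspace M" and N: "diffop_free.subspace N"
    and x: "\<And>x. x \<in> N \<Longrightarrow> \<not> {r. r *s x \<in> M} \<subseteq> point_ideal b"
  shows "b \<notin> quot_support N M"
proof -
  obtain G where G: "finite G" "G \<subseteq> N" "N \<subseteq> diffop_free.span G"
    by (rule artin_rees[OF N]) (rule that)
  have "\<forall>g\<in>G. \<exists>r. r *s g \<in> M \<and> r \<notin> point_ideal b" using G(2) x by blast
  then obtain r where r: "\<And>g. g \<in> G \<Longrightarrow> r g *s g \<in> M" "\<And>g. g \<in> G \<Longrightarrow> r g \<notin> point_ideal b"
    by metis
  define s where "s = (\<Prod>g\<in>G. r g)"
  have "(\<Prod>g\<in>H. r g) \<notin> point_ideal b" if "finite H" "H \<subseteq> G" for H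
    using that by (induction H) (auto simp: one_notin_point_ideal point_ideal_prime r(2))
  then have s: "s \<notin> point_ideal b" unfolding s_def using G(1) by blast
  have "s *s g \<in> M" if "g \<in> G" for g
  proof -
    have "s = (\<Prod>h\<in>G - {g}. r h) * r g" unfolding s_def using G(1) that by (subst prod.remove) (auto simp: mult.commute)
    then have "s *s g = (\<Prod>h\<in>G - {g}. r h) *s (r g *s g)" by (simp only: diffop_free.scale_scale)
    then show ?thesis using diffop_free.subspace_scale[OF M r(1)[OF that]] by simp
  qed
  then have "G \<subseteq> {p. s *s p \<in> M}" by blast
  moreover have "diffop_free.subspace {p. s *s p \<in> M}"
    unfolding diffop_free.subspace_def
  proof (intro conjI ballI allI; unfold mem_Collect_eq)
    show "s *s 0 \<in> M" using diffop_free.subspace_0[OF M] by simp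
    show "s *s (p + q) \<in> M" if "s *s p \<in> M" "s *s q \<in> M" for p q
      using diffop_free.subspace_add[OF M] that by (simp add: diffop_free.scale_right_distrib)
    show "s *s (t *s p) \<in> M" if "s *s p \<in> M" for t p
    proof -
      have "s *s (t *s p) = t *s (s *s p)" by (simp only: diffop_free.scale_scale mult.commute)
      then show ?thesis using diffop_free.subspace_scale[OF M, of "s *s p" t] that by simp
    qed
  qed
  ultimately have "diffop_free.span G \<subseteq> {p. s *s p \<in> M}" by (rule diffop_free.span_minimal)
  then have "s \<in> quot_annihilator N M" using G(3) by (auto simp: quot_annihilator_eq[OF M])
  then show ?thesis using s by (auto simp: quot_support_def)
qed

theorem proposition4p1:
  fixes M :: "(('n::finite) diffop ^ 'q::finite) set"
  assumes "CARD('n) \<ge> 2"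
    and "diffop_free.subspace M"
  shows "willems_closure M =
           {x. \<forall>b\<in>rat_points. \<not> {r. r *s x \<in> M} \<subseteq> point_ideal b}
       \<and> (diffop_free.subspace (willems_closure M)
           \<and> M \<subseteq> willems_closure M
           \<and> quot_support (willems_closure M) M \<inter> rat_points = {})
       \<and> (\<forall>N. diffop_free.subspace N \<and> M \<subseteq> N \<and> quot_support N M \<inter> rat_points = {}
              \<longrightarrow> N \<subseteq> willems_closure M)"
proof (intro conjI allI impI)
  note M = \<open>diffop_free.subspace M\<close>
  show "willems_closure M = {x. \<forall>b\<in>rat_points. \<not> {r. r *s x \<in> M} \<subseteq> point_ideal b}"
    using in_willems_closureI[OF M] willems_closureD[OF M] by blast
  show "diffop_free.subspace (willems_closure M)" by (rule subspace_willems_closure)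
  show "M \<subseteq> willems_closure M" by (rule subset_willems_closure)
  show "quot_support (willems_closure M) M \<inter> rat_points = {}"
    using quot_support_disjoint[OF M subspace_willems_closure willems_closureD[OF M]] by blast
  fix N assume N: "diffop_free.subspace N \<and> M \<subseteq> N \<and> quot_support N M \<inter> rat_points = {}"
  show "N \<subseteq> willems_closure M"
  proof
    fix x assume "x \<in> N"
    \<comment> \<open>Passing from the quotient to a single element enlarges the annihilator, so not
      lying in a point ideal is inherited.\<close>
    then have "quot_annihilator N M \<subseteq> {r. r *s x \<in> M}" by (auto simp: quot_annihilator_eq[OF M])
    moreover have "\<not> quot_annihilator N M \<subseteq> point_ideal b" if "b \<in> rat_points" for b
      using N that by (auto simp: quot_support_def)
    ultimately show "x \<in> willems_closure M" by (intro in_willems_closureI[OF M]) blast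
  qed
qed

end
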